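(* Let $\mathcal{P}=(P,d\mu,d\sigma)$ be an $n$-dimensional system with $n\ge2$. For every $T\in\mathbb{R}$ there exists $u\in\mathcal{M}^{\frac{n}{n-1}}(P)$ which minimizes $F_{\mathcal{P}}(T,\cdot)$ on $\mathcal{M}^{1}(P)$, i.e. $F_{\mathcal{P}}(T,u)\le F_{\mathcal{P}}(T,v)$ for all $v\in\mathcal{M}^1(P)$.
   Context: An $n$-dimensional system is a triple $\mathcal{P}=(P,d\mu,d\sigma)$ where $P$ is a simple polytope in an $n$-dimensional real affine space $V$ (a compact subset with non-empty interior that is a finite intersection of closed half spaces, such that every vertex is the intersection of exactly $n$ facets), $d\mu$ is the restriction to $P$ of a translation-invariant measure on $V$ that is positive and finite on bounded non-empty open sets (i.e. a positive multiple of Lebesgue measure), and $d\sigma$ is a measure on the boundary $\partial P$ whose restriction to each facet is a positive multiple of the Lebesgue measure of the affine hyperplane spanned by that facet. For $p\ge1$, $\mathcal{M}^p(P)$ is the set of lower semicontinuous functions $u:P\to(0,\infty]$ that are log-convex ($u((1-t)x+ty)\le u(x)^{1-t}u(y)^t$ for $x,y\in P$, $t\in[0,1]$) and satisfy $\int_P u\,d\mu=\int_P d\mu$ and $\int_P u^p\,d\mu<\infty$. For $u\in\mathcal{M}^1(P)$: entropy $S_{\mathcal{P}}(u):=-\frac{1}{\int_Pd\mu}\int_P u\log u\,d\mu\in[-\infty,0]$; internal $\mu$-energy $U_{\mathcal{P}}(u):=\frac{1}{\int_Pd\mu}\int_{\partial P}u\,d\sigma\in(0,\infty]$; and for $T\in\mathbb{R}$,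 free $\mu$-energy $F_{\mathcal{P}}(T,u):=U_{\mathcal{P}}(u)-TS_{\mathcal{P}}(u)$ if $S_{\mathcal{P}}(u)>-\infty$, and $F_{\mathcal{P}}(T,u):=+\infty$ if $S_{\mathcal{P}}(u)=-\infty$. *)

theory Defs
  imports "HOL-Analysis.Analysis"
begin

definition simple_polytope :: "(real^'n) set \<Rightarrow> bool" where
  "simple_polytope P \<longleftrightarrow> polyhedron P \<and> compact P \<and> interior P \<noteq> {} \<and>
     (\<forall>v. v extreme_point_of P \<longrightarrow> card {F. F facet_of P \<and> v \<in> F} = CARD('n))"

definition lebesgue_multiple :: "(real^'n) measure \<Rightarrow> bool" where
  "lebesgue_multiple mu \<longleftrightarrow> (\<exists>c::real. c > 0 \<and> mu = density lborel (\<lambda>_. ennreal c))"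

text \<open>Boundary measure: a measure on the Borel sets whose restriction to each facet F is a
  positive multiple of the Lebesgue measure of the affine hyperplane spanned by F. The Lebesgue
  measure of that hyperplane is realised (up to a positive factor, which is arbitrary anyway)
  as the image of Lebesgue measure on real^'m under an injective affine parametrisation
  y \<mapsto> p + L y of the affine hull of F.\<close>
definition boundary_measure :: "('m::finite) itself \<Rightarrow> (real^'n) set \<Rightarrow> (real^'n) measure \<Rightarrow> bool" where
  "boundary_measure _ P sg \<longleftrightarrow> sets sg = sets borel \<and>
     emeasure sg (- frontier P) = 0 \<and>
     (\<forall>F. F facet_of P \<longrightarrow>
        (\<exists>(c::real) (p::real^'n) (L::real^'m \<Rightarrow> real^'n).
           c > 0 \<and> linear L \<and> inj L \<and> (\<lambda>y. p + L y) ` UNIV = affine hull F \<and>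
           (\<forall>A \<in> sets borel. emeasure sg (A \<inter> F) =
               ennreal c * emeasure lborel {y. p + L y \<in> A \<inter> F})))"

definition system :: "('m::finite) itself \<Rightarrow> (real^'n) set \<Rightarrow> (real^'n) measure \<Rightarrow> (real^'n) measure \<Rightarrow> bool" where
  "system m P mu sg \<longleftrightarrow> simple_polytope P \<and> lebesgue_multiple mu \<and> boundary_measure m P sg"

text \<open>Real powers of extended nonnegative reals (a > 0 intended); a^0 = 1, \<infinity>^s = \<infinity> for s > 0.\<close>
definition epow :: "ennreal \<Rightarrow> real \<Rightarrow> ennreal" where
  "epow a s = (if s = 0 then 1 else if a = \<infinity> then (if s > 0 then \<infinity> else 0)
               else ennreal (enn2real a powr s))"

definition lsc_on :: "(real^'n) set \<Rightarrow> (real^'n \<Rightarrow> ennreal) \<Rightarrow> bool" where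
  "lsc_on P u \<longleftrightarrow> (\<forall>x\<in>P. u x \<le> Liminf (at x within P) u)"

definition log_convex_on :: "(real^'n) set \<Rightarrow> (real^'n \<Rightarrow> ennreal) \<Rightarrow> bool" where
  "log_convex_on P u \<longleftrightarrow> (\<forall>x\<in>P. \<forall>y\<in>P. \<forall>t::real. 0 \<le> t \<and> t \<le> 1 \<longrightarrow>
      u ((1 - t) *\<^sub>R x + t *\<^sub>R y) \<le> epow (u x) (1 - t) * epow (u y) t)"

definition Mp :: "real \<Rightarrow> (real^'n) set \<Rightarrow> (real^'n) measure \<Rightarrow> (real^'n \<Rightarrow> ennreal) set" where
  "Mp p P mu = {u. lsc_on P u \<and> log_convex_on P u \<and> (\<forall>x\<in>P. 0 < u x) \<and>
      (\<integral>\<^sup>+x\<in>P. u x \<partial>mu) = emeasure mu P \<and> (\<integral>\<^sup>+x\<in>P. epow (u x) p \<partial>mu) < \<infinity>}"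

definition xlogx :: "ennreal \<Rightarrow> ereal" where
  "xlogx a = (if a = \<infinity> then \<infinity> else ereal (enn2real a * ln (enn2real a)))"

text \<open>\<integral>_P u log u d\<mu>: the integrand is bounded below, so it is the integral of the
  positive part minus the (finite) integral of the negative part.\<close>
definition int_ulogu :: "(real^'n) set \<Rightarrow> (real^'n) measure \<Rightarrow> (real^'n \<Rightarrow> ennreal) \<Rightarrow> ereal" where
  "int_ulogu P mu u =
     enn2ereal (\<integral>\<^sup>+x\<in>P. e2ennreal (max 0 (xlogx (u x))) \<partial>mu)
   - enn2ereal (\<integral>\<^sup>+x\<in>P. e2ennreal (max 0 (- xlogx (u x))) \<partial>mu)"

definition entropy :: "(real^'n) set \<Rightarrow> (real^'n) measure \<Rightarrow> (real^'n \<Rightarrow> ennreal) \<Rightarrow> ereal" where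
  "entropy P mu u = - (ereal (1 / enn2real (emeasure mu P)) * int_ulogu P mu u)"

definition internal_energy ::
  "(real^'n) set \<Rightarrow> (real^'n) measure \<Rightarrow> (real^'n) measure \<Rightarrow> (real^'n \<Rightarrow> ennreal) \<Rightarrow> ennreal" where
  "internal_energy P mu sg u =
     ennreal (1 / enn2real (emeasure mu P)) * (\<integral>\<^sup>+x\<in>frontier P. u x \<partial>sg)"

definition free_energy ::
  "(real^'n) set \<Rightarrow> (real^'n) measure \<Rightarrow> (real^'n) measure \<Rightarrow> real \<Rightarrow> (real^'n \<Rightarrow> ennreal) \<Rightarrow> ereal" where
  "free_energy P mu sg T u =
     (if entropy P mu u = - \<infinity> then \<infinity>
      else enn2ereal (internal_energy P mu sg u) - ereal T * entropy P mu u)"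

end

theory Submission
  imports Defs "HOL-Complex_Analysis.Great_Picard" "HOL-Real_Asymp.Real_Asymp"
begin

text \<open>
  Let \<open>p = n / (n - 1)\<close>. A log-convex \<open>u\<close> is bounded at an interior point by the larger of its values
  at the two boundary points of any line through that point. Taking the \<open>n\<close> coordinate directions,
  \<open>u\<close> is at most \<open>g i\<close>, a function not depending on the \<open>i\<close>-th coordinate whose integral over the
  other coordinates is controlled by the boundary integral of \<open>u\<close>. The Loomis--Whitney inequality
  then gives a bound of the integral of \<open>u powr p\<close> by the \<open>p\<close>-th power of the internal energy.

  Consequently the entropy grows at most like the logarithm of the energy, so minimizing sequences
  have bounded energy for every sign of \<open>T\<close>. Being convex and locally bounded, they have a subsequence
  that converges in the interior. The bound on the integrals of \<open>u powr p\<close> makes the total mass and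
  the entropy converge; the limit, extended radially to the boundary, is lower semicontinuous and
  log-convex, and the energy is lower semicontinuous along the subsequence by Fatou's lemma.
\<close>

section \<open>Powers of extended nonnegative reals\<close>

text \<open>The obstacle is the boundary. Fixed mass makes members of \<open>Mp 1 P mu\<close>
  uniformly bounded near each interior point, but these bounds degenerate towards the frontier, so
  mass and entropy of a sequence could escape there. For \<open>T < 0\<close> the entropy term also
  pulls the free energy down. One estimate of a power above 1 meets both problems. Its exponent n /
  (n - 1) comes from Hoelder: \<open>u\<close> lies below n functions \<open>g i\<close>, each used
  with exponent 1 / (n - 1), and integrating out one coordinate leaves n - 1 factors whose exponents
  sum to 1. Since x ln x is of smaller order than this power, the entropy is continuous along the
  sequence and not only semicontinuous, so the sign of \<open>T\<close> does not matter in the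
  limit. That the limit is positive inside is a separate point: log-convexity would spread a zero
  over the whole interior, against the conserved mass. Frontier values are not limits of values;
  interpolation between an interior base point and a frontier point shows that the rebuilt values
  lie below the lower limit of the sequence.\<close>

lemma epow_ennreal: "0 \<le> r \<Longrightarrow> 0 < s \<Longrightarrow> epow (ennreal r) s = ennreal (r powr s)"
  by (simp add: epow_def)

lemma epow_0 [simp]: "0 < s \<Longrightarrow> epow 0 s = 0"
  by (simp add: epow_def)

lemma epow_top [simp]: "0 < s \<Longrightarrow> epow \<infinity> s = \<infinity>" "0 < s \<Longrightarrow> epow top s = top"
  by (simp_all add: epow_def)

lemma epow_zero_right [simp]: "epow a 0 = 1"
  by (simp add: epow_def)

lemma epow_one_right [simp]: "epow a 1 = a"
  by (auto simp: epow_def ennreal_enn2real_if)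

lemma epow_one_left [simp]: "epow 1 s = 1"
  by (simp add: epow_def)

lemma epow_mono: "a \<le> b \<Longrightarrow> 0 \<le> s \<Longrightarrow> epow a s \<le> epow b s"
  by (cases a; cases b) (auto simp: epow_def top_unique intro!: ennreal_leI powr_mono2)

lemma epow_mult: "0 < s \<Longrightarrow> epow (a * b) s = epow a s * epow b s"
proof (cases a; cases b)
  fix r q :: real
  assume "0 < s" "0 \<le> r" "a = ennreal r" "0 \<le> q" "b = ennreal q"
  then show ?thesis
    by (simp add: epow_ennreal powr_mult flip: ennreal_mult)
next
  fix r :: real
  assume "0 < s" "0 \<le> r" "a = ennreal r" "b = top"
  then show ?thesis
    by (cases "r = 0") (auto simp: epow_ennreal ennreal_mult_top)
next
  fix r :: real
  assume "0 < s" "0 \<le> r" "b = ennreal r" "a = top"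
  then show ?thesis
    by (cases "r = 0") (auto simp: epow_ennreal ennreal_top_mult)
qed (simp add: ennreal_top_mult)

lemma epow_prod: "0 < s \<Longrightarrow> epow (\<Prod>i\<in>I. f i) s = (\<Prod>i\<in>I. epow (f i) s)"
  by (induction I rule: infinite_finite_induct) (auto simp: epow_mult)

lemma measurable_epow [measurable]:
  assumes [measurable]: "f \<in> borel_measurable M"
  shows "(\<lambda>x. epow (f x) s) \<in> borel_measurable M"
proof (cases "s = 0")
  case False
  then show ?thesis
    unfolding epow_def by measurable
qed simp

section \<open>Hoelder's inequality for equal exponents\<close>

lemma epow_prod_le_mean:
  fixes h :: "'a \<Rightarrow> ennreal"
  assumes "finite K" "K \<noteq> {}"
  shows "(\<Prod>i\<in>K. epow (h i) (1 / card K)) \<le> (\<Sum>i\<in>K. ennreal (1 / card K) * h i)"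
proof (cases "\<exists>i\<in>K. h i = top")
  case True
  have "card K > 0"
    using assms by (simp add: card_gt_0_iff)
  then have "(\<Sum>i\<in>K. ennreal (1 / card K) * h i) = top"
  proof -
    obtain i where "i \<in> K" "h i = top"
      using True by blast
    then show ?thesis
      using \<open>card K > 0\<close> assms by (simp add: sum.remove ennreal_mult_top)
  qed
  then show ?thesis
    by simp
next
  case False
  define r where "r i = enn2real (h i)" for i
  have h: "h i = ennreal (r i)" if "i \<in> K" for i
    using False that by (auto simp: r_def ennreal_enn2real_if)
  have K: "card K > 0"
    using assms by (simp add: card_gt_0_iff)
  have r0: "0 \<le> r i" for i
    by (simp add: r_def)
  have "(\<Prod>i\<in>K. epow (h i) (1 / card K)) = epow (\<Prod>i\<in>K. h i) (1 / card K)"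
    using K by (simp add: epow_prod)
  also have "(\<Prod>i\<in>K. h i) = ennreal (\<Prod>i\<in>K. r i)"
    using r0 by (simp add: h prod_ennreal)
  also have "epow \<dots> (1 / card K) = ennreal ((\<Prod>i\<in>K. r i) powr (1 / card K))"
    using K r0 by (simp add: epow_ennreal prod_nonneg)
  also have "\<dots> \<le> ennreal (\<Sum>i\<in>K. r i / card K)"
    using assms r0 by (intro ennreal_leI arith_geom_mean) auto
  also have "\<dots> = (\<Sum>i\<in>K. ennreal (1 / card K) * h i)"
    using r0 by (simp add: h sum_ennreal flip: ennreal_mult)
  finally show ?thesis .
qed

text \<open>Divide each \<open>h i\<close> by its integral \<open>a i\<close>, compare the product
  with the arithmetic mean pointwise, and integrate; each normalized function contributes
  \<open>1 / card K\<close>.\<close>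

lemma nn_integral_prod_epow_le:
  fixes h :: "'i \<Rightarrow> 'a \<Rightarrow> ennreal"
  assumes K: "finite K" "K \<noteq> {}" and [measurable]: "\<And>i. i \<in> K \<Longrightarrow> h i \<in> borel_measurable M"
  shows "(\<integral>\<^sup>+x. (\<Prod>i\<in>K. epow (h i x) (1 / card K)) \<partial>M)
    \<le> (\<Prod>i\<in>K. epow (\<integral>\<^sup>+x. h i x \<partial>M) (1 / card K))"
proof -
  define a where "a i = (\<integral>\<^sup>+x. h i x \<partial>M)" for i
  define s where "s = 1 / real (card K)"
  have s: "s > 0"
    using K by (simp add: s_def card_gt_0_iff)
  \<comment> \<open>Zero integrals are separated first because 0 * \<open>top\<close> = 0 in
    \<open>ennreal\<close>: the right side can vanish even if another integral is infinite.\<close>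
  consider (zero) i where "i \<in> K" "a i = 0" | (top) i where "i \<in> K" "a i = top" "\<forall>j\<in>K. a j \<noteq> 0"
    | (fin) "\<And>i. i \<in> K \<Longrightarrow> a i \<noteq> 0 \<and> a i \<noteq> top"
    by blast
  then show ?thesis
  proof cases
    case zero
    then have "AE x in M. h i x = 0"
      by (simp add: a_def nn_integral_0_iff_AE)
    then have "AE x in M. (\<Prod>i\<in>K. epow (h i x) s) = 0"
      by eventually_elim (use zero K s in \<open>auto intro!: bexI[of _ i]\<close>)
    then have "(\<integral>\<^sup>+x. (\<Prod>i\<in>K. epow (h i x) s) \<partial>M) = (\<integral>\<^sup>+x. 0 \<partial>M)"
      by (rule nn_integral_cong_AE)
    then show ?thesis
      by (simp add: s_def)
  next
    case top
    have "epow (a j) s \<noteq> 0" if "j \<in> K" for j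
      using top s that by (cases "a j") (auto simp: epow_ennreal)
    then have "(\<Prod>i\<in>K. epow (a i) s) = top"
      using top s K by (subst prod.remove[of _ i]) (auto simp: ennreal_top_mult)
    then show ?thesis
      by (simp add: s_def a_def)
  next
    case fin
    define A where "A = (\<Prod>i\<in>K. epow (a i) s)"
    have "(\<integral>\<^sup>+x. (\<Prod>i\<in>K. epow (h i x) s) \<partial>M) \<le> (\<integral>\<^sup>+x. A * (\<Sum>i\<in>K. ennreal s * (h i x / a i)) \<partial>M)"
    proof (rule nn_integral_mono)
      fix x
      have "(\<Prod>i\<in>K. epow (h i x) s) = (\<Prod>i\<in>K. epow (a i) s * epow (h i x / a i) s)"
      proof (intro prod.cong refl)
        fix i assume "i \<in> K"
        then have "a i * (h i x / a i) = h i x"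
          using fin[of i] by (simp add: ennreal_times_divide mult_divide_eq_ennreal mult.commute[of "a i"])
        then show "epow (h i x) s = epow (a i) s * epow (h i x / a i) s"
          using s by (simp flip: epow_mult)
      qed
      also have "\<dots> = A * (\<Prod>i\<in>K. epow (h i x / a i) s)"
        by (simp add: prod.distrib A_def)
      also have "\<dots> \<le> A * (\<Sum>i\<in>K. ennreal s * (h i x / a i))"
        using epow_prod_le_mean[OF K, of "\<lambda>i. h i x / a i"] by (intro mult_left_mono) (auto simp: s_def)
      finally show "(\<Prod>i\<in>K. epow (h i x) s) \<le> A * (\<Sum>i\<in>K. ennreal s * (h i x / a i))" .
    qed
    also have "\<dots> = A * (\<Sum>i\<in>K. ennreal s * (a i / a i))"
      by (simp add: nn_integral_cmult nn_integral_sum a_def nn_integral_divide)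
    also have "(\<Sum>i\<in>K. ennreal s * (a i / a i)) = (\<Sum>i\<in>K. ennreal s)"
      using fin by (intro sum.cong refl) (simp add: less_top ennreal_divide_self)
    also have "(\<Sum>i\<in>K. ennreal s) = 1"
      using s K by (simp add: s_def ennreal_of_nat_eq_real_of_nat flip: ennreal_mult')
    finally show ?thesis
      by (simp add: A_def s_def a_def)
  qed
qed

section \<open>The Loomis--Whitney inequality\<close>

definition line_integral :: "'n \<Rightarrow> (real^'n \<Rightarrow> ennreal) \<Rightarrow> real^'n \<Rightarrow> ennreal" where
  "line_integral j f x = (\<integral>\<^sup>+s. f (x + s *\<^sub>R axis j 1) \<partial>lborel)"

text \<open>The weight that turns a function invariant along axis \<open>j\<close> into its integral
  over the other coordinates: each line in this direction meets the slab in length 1. Integrals in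
  dimension n - 1 thus stay on \<open>real^'n\<close>.\<close>

definition slab :: "'n \<Rightarrow> real^'n \<Rightarrow> ennreal" where
  "slab j x = indicator {0..1} (x $ j)"

definition line_invariant :: "'n \<Rightarrow> (real^'n \<Rightarrow> ennreal) \<Rightarrow> bool" where
  "line_invariant j f \<longleftrightarrow> (\<forall>x s. f (x + s *\<^sub>R axis j 1) = f x)"

lemma measurable_slab [measurable]: "slab j \<in> borel_measurable borel"
  unfolding slab_def by measurable

lemma measurable_line_integral [measurable]:
  assumes [measurable]: "f \<in> borel_measurable borel"
  shows "line_integral j f \<in> borel_measurable borel"
proof -
  have "(\<lambda>(x, s). f (x + s *\<^sub>R axis j 1)) \<in> borel_measurable (borel \<Otimes>\<^sub>M lborel)"
    by measurable
  then show ?thesis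
    unfolding line_integral_def by measurable
qed

lemma nn_integral_lborel_translate:
  fixes f :: "'a::euclidean_space \<Rightarrow> ennreal"
  assumes "f \<in> borel_measurable borel"
  shows "(\<integral>\<^sup>+x. f (x + a) \<partial>lborel) = (\<integral>\<^sup>+x. f x \<partial>lborel)"
proof -
  have "(\<integral>\<^sup>+x. f x \<partial>lborel) = (\<integral>\<^sup>+x. f x \<partial>distr lborel borel ((+) a))"
    by (simp add: lborel_distr_plus)
  also have "\<dots> = (\<integral>\<^sup>+x. f (a + x) \<partial>lborel)"
    using assms by (intro nn_integral_distr) auto
  finally show ?thesis
    by (simp add: add.commute)
qed

text \<open>A translation along the axis moves the shift from \<open>f\<close> to the slab, and for
  fixed \<open>x\<close> the admissible shifts form an interval of length 1.\<close>

lemma nn_integral_line_integral: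
  fixes f :: "real^'n \<Rightarrow> ennreal"
  assumes [measurable]: "f \<in> borel_measurable borel"
  shows "(\<integral>\<^sup>+x. line_integral j f x * slab j x \<partial>lborel) = (\<integral>\<^sup>+x. f x \<partial>lborel)"
proof -
  have "(\<integral>\<^sup>+x. line_integral j f x * slab j x \<partial>lborel)
      = (\<integral>\<^sup>+x. (\<integral>\<^sup>+s. f (x + s *\<^sub>R axis j 1) * slab j x \<partial>lborel) \<partial>lborel)"
    unfolding line_integral_def by (simp add: nn_integral_multc)
  also have "\<dots> = (\<integral>\<^sup>+s. (\<integral>\<^sup>+x. f (x + s *\<^sub>R axis j 1) * slab j x \<partial>lborel) \<partial>lborel)"
    by (rule lborel_pair.Fubini'[symmetric]) measurable
  also have "\<dots> = (\<integral>\<^sup>+s. (\<integral>\<^sup>+x. f x * slab j (x + (- s) *\<^sub>R axis j 1) \<partial>lborel) \<partial>lborel)"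
  proof (rule nn_integral_cong)
    fix s :: real
    show "(\<integral>\<^sup>+x. f (x + s *\<^sub>R axis j 1) * slab j x \<partial>lborel)
        = (\<integral>\<^sup>+x. f x * slab j (x + (- s) *\<^sub>R axis j 1) \<partial>lborel)"
      using nn_integral_lborel_translate[of "\<lambda>x. f x * slab j (x + (- s) *\<^sub>R axis j 1)" "s *\<^sub>R axis j 1"]
      by simp
  qed
  also have "\<dots> = (\<integral>\<^sup>+x. (\<integral>\<^sup>+s. f x * slab j (x + (- s) *\<^sub>R axis j 1) \<partial>lborel) \<partial>lborel)"
    by (rule lborel_pair.Fubini') measurable
  also have "\<dots> = (\<integral>\<^sup>+x. f x \<partial>lborel)"
  proof (rule nn_integral_cong)
    fix x :: "real^'n"
    have "slab j (x + (- s) *\<^sub>R axis j 1) = indicator {x $ j - 1..x $ j} s" for s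
      by (auto simp: slab_def indicator_def)
    then show "(\<integral>\<^sup>+s. f x * slab j (x + (- s) *\<^sub>R axis j 1) \<partial>lborel) = f x"
      by (simp add: nn_integral_cmult)
  qed
  finally show ?thesis .
qed

lemma line_integral_mult_invariant:
  assumes [measurable]: "f \<in> borel_measurable borel" and "line_invariant j g"
  shows "line_integral j (\<lambda>x. f x * g x) = (\<lambda>x. line_integral j f x * g x)"
  using assms(2) by (auto simp: line_integral_def line_invariant_def nn_integral_multc)

lemma line_invariant_slab: "i \<noteq> j \<Longrightarrow> line_invariant j (slab i)"
  by (simp add: line_invariant_def slab_def axis_def)

lemma line_invariant_mult:
  "line_invariant j f \<Longrightarrow> line_invariant j g \<Longrightarrow> line_invariant j (\<lambda>x. f x * g x)"
  by (simp add: line_invariant_def)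

lemma line_invariant_prod:
  "(\<And>i. i \<in> I \<Longrightarrow> line_invariant j (f i)) \<Longrightarrow> line_invariant j (\<lambda>x. \<Prod>i\<in>I. f i x)"
  by (simp add: line_invariant_def)

lemma line_invariant_line_integral:
  assumes "line_invariant j f"
  shows "line_invariant j (line_integral k f)"
  unfolding line_invariant_def line_integral_def
proof safe
  fix x :: "real^'a" and s :: real
  have "x + s *\<^sub>R axis j 1 + t *\<^sub>R axis k 1 = (x + t *\<^sub>R axis k 1) + s *\<^sub>R axis j 1" for t :: real
    by simp
  then show "(\<integral>\<^sup>+t. f (x + s *\<^sub>R axis j 1 + t *\<^sub>R axis k 1) \<partial>lborel) = (\<integral>\<^sup>+s. f (x + s *\<^sub>R axis k 1) \<partial>lborel)"
    using assms unfolding line_invariant_def by presburger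
qed

lemma line_invariant_line_integral_same:
  assumes [measurable]: "f \<in> borel_measurable borel"
  shows "line_invariant j (line_integral j f)"
  unfolding line_invariant_def line_integral_def
proof safe
  fix x :: "real^'a" and s :: real
  show "(\<integral>\<^sup>+t. f (x + s *\<^sub>R axis j 1 + t *\<^sub>R axis j 1) \<partial>lborel) = (\<integral>\<^sup>+s. f (x + s *\<^sub>R axis j 1) \<partial>lborel)"
    using nn_integral_lborel_translate[of "\<lambda>t. f (x + t *\<^sub>R axis j 1)" s]
    by (simp add: algebra_simps)
qed

definition iter_integral :: "'n list \<Rightarrow> (real^'n \<Rightarrow> ennreal) \<Rightarrow> real^'n \<Rightarrow> ennreal" where
  "iter_integral js f = foldr line_integral js f"

lemma iter_integral_simps [simp]:
  "iter_integral [] f = f"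
  "iter_integral (j # js) f = line_integral j (iter_integral js f)"
  by (simp_all add: iter_integral_def)

lemma measurable_iter_integral [measurable]:
  "f \<in> borel_measurable borel \<Longrightarrow> iter_integral js f \<in> borel_measurable borel"
  by (induction js) auto

lemma line_invariant_iter_integral:
  "line_invariant j f \<Longrightarrow> line_invariant j (iter_integral js f)"
  by (induction js) (auto intro: line_invariant_line_integral)

lemma line_invariant_iter_integral_mem:
  "f \<in> borel_measurable borel \<Longrightarrow> j \<in> set js \<Longrightarrow> line_invariant j (iter_integral js f)"
  by (induction js)
     (auto intro: line_invariant_line_integral line_invariant_line_integral_same measurable_iter_integral)

text \<open>Coordinates are integrated out one at a time. The weights collected so far,
  \<open>g\<close> and the slabs of other directions, are constant along the next axis and pass
  through its line integral; \<open>distinct js\<close> keeps each slab away from its own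
  direction.\<close>

lemma nn_integral_iter_integral:
  assumes "f \<in> borel_measurable borel" "distinct js" "g \<in> borel_measurable borel"
    and "\<And>j. j \<in> set js \<Longrightarrow> line_invariant j g"
  shows "(\<integral>\<^sup>+x. f x * g x \<partial>lborel)
    = (\<integral>\<^sup>+x. iter_integral js f x * (g x * (\<Prod>j\<in>set js. slab j x)) \<partial>lborel)"
  using assms
proof (induction js arbitrary: g)
  case (Cons j js)
  note [measurable] = \<open>f \<in> borel_measurable borel\<close> \<open>g \<in> borel_measurable borel\<close>
  define h where "h x = g x * (\<Prod>j\<in>set js. slab j x)" for x
  have [measurable]: "h \<in> borel_measurable borel"
    unfolding h_def by measurable
  have h: "line_invariant j h"
    unfolding h_def using Cons.prems
    by (intro line_invariant_mult line_invariant_prod line_invariant_slab) auto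
  have "(\<integral>\<^sup>+x. f x * g x \<partial>lborel) = (\<integral>\<^sup>+x. iter_integral js f x * h x \<partial>lborel)"
    unfolding h_def using Cons by auto
  also have "\<dots> = (\<integral>\<^sup>+x. line_integral j (\<lambda>x. iter_integral js f x * h x) x * slab j x \<partial>lborel)"
    by (rule nn_integral_line_integral[symmetric]) simp
  also have "\<dots> = (\<integral>\<^sup>+x. line_integral j (iter_integral js f) x * h x * slab j x \<partial>lborel)"
    using h by (simp add: line_integral_mult_invariant)
  finally show ?case
    using Cons.prems by (simp add: h_def mult_ac)
qed simp

text \<open>Walk from the origin to \<open>x\<close> along one coordinate axis after the
  other.\<close>

lemma line_invariant_all_imp_const:
  fixes f :: "real^'n \<Rightarrow> ennreal"
  assumes "\<And>j. line_invariant j f"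
  shows "f x = f 0"
proof -
  have "f (\<Sum>j\<in>J. (x $ j) *\<^sub>R axis j 1) = f 0" if "finite J" for J
    using that
  proof induction
    case (insert j J)
    have "f (x + s *\<^sub>R axis j 1) = f x" for x s
      using assms[of j] by (simp add: line_invariant_def)
    from this[of "\<Sum>j\<in>J. (x $ j) *\<^sub>R axis j 1"] insert show ?case
      by (simp add: add.commute)
  qed simp
  from this[of UNIV] show ?thesis
    by (simp add: basis_expansion flip: scalar_mult_eq_scaleR)
qed

lemma nn_integral_prod_slab: "(\<integral>\<^sup>+x. (\<Prod>j\<in>UNIV. slab j x) \<partial>(lborel :: (real^'n) measure)) = 1"
proof -
  have "(\<Prod>j\<in>UNIV. slab j x) = indicator (cbox 0 1) (x :: real^'n)" for x
    by (auto simp: slab_def indicator_def mem_box_cart)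
  then have "(\<integral>\<^sup>+x. (\<Prod>j\<in>UNIV. slab j x) \<partial>(lborel :: (real^'n) measure)) = emeasure lborel (cbox 0 (1 :: real^'n))"
    by simp
  also have "\<dots> = 1"
    by (auto simp: emeasure_lborel_cbox_eq Basis_vec_def inner_axis intro!: prod.neutral)
  finally show ?thesis .
qed

text \<open>The full iterated integral is invariant in every direction, hence constant, so it may be
  read off at any point; 0 is a convenient one.\<close>

lemma nn_integral_eq_iter_integral_all:
  fixes f :: "real^'n \<Rightarrow> ennreal"
  assumes [measurable]: "f \<in> borel_measurable borel" and js: "distinct js" "set js = UNIV"
  shows "(\<integral>\<^sup>+x. f x \<partial>lborel) = iter_integral js f 0"
proof -
  have "(\<integral>\<^sup>+x. f x \<partial>lborel) = (\<integral>\<^sup>+x. iter_integral js f x * (\<Prod>j\<in>UNIV. slab j x) \<partial>lborel)"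
    using nn_integral_iter_integral[of f js "\<lambda>_. 1"] js by (simp add: line_invariant_def)
  also have "\<dots> = (\<integral>\<^sup>+x. iter_integral js f 0 * (\<Prod>j\<in>UNIV. slab j x) \<partial>(lborel :: (real^'n) measure))"
  proof (rule nn_integral_cong)
    fix x :: "real^'n"
    have "iter_integral js f x = iter_integral js f 0"
      using js by (intro line_invariant_all_imp_const line_invariant_iter_integral_mem) auto
    then show "iter_integral js f x * (\<Prod>j\<in>UNIV. slab j x) = iter_integral js f 0 * (\<Prod>j\<in>UNIV. slab j x)"
      by simp
  qed
  finally show ?thesis
    by (simp add: nn_integral_cmult nn_integral_prod_slab)
qed

text \<open>Direction \<open>i\<close> is skipped in the iteration: \<open>f\<close> itself supplies
  the invariance along it, and the given slab supplies the weight that is otherwise missing.\<close>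

lemma nn_integral_slab_eq_iter_integral:
  fixes f :: "real^'n \<Rightarrow> ennreal"
  assumes [measurable]: "f \<in> borel_measurable borel" and f: "line_invariant i f"
    and js: "distinct js" "set js = UNIV"
  shows "(\<integral>\<^sup>+x. f x * slab i x \<partial>lborel) = iter_integral (filter (\<lambda>j. j \<noteq> i) js) f 0"
proof -
  define ks where "ks = filter (\<lambda>j. j \<noteq> i) js"
  have ks: "distinct ks" "set ks = UNIV - {i}"
    using js by (auto simp: ks_def)
  have inv: "line_invariant j (iter_integral ks f)" for j
  proof (cases "j = i")
    case True
    with f show ?thesis by (simp add: line_invariant_iter_integral)
  next
    case False
    with ks show ?thesis by (intro line_invariant_iter_integral_mem) simp_all
  qed
  have "(\<integral>\<^sup>+x. f x * slab i x \<partial>lborel)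
      = (\<integral>\<^sup>+x. iter_integral ks f x * (slab i x * (\<Prod>j\<in>UNIV - {i}. slab j x)) \<partial>lborel)"
    using nn_integral_iter_integral[of f ks "slab i"] ks by (auto intro: line_invariant_slab)
  also have "\<dots> = (\<integral>\<^sup>+x. iter_integral ks f 0 * (\<Prod>j\<in>UNIV. slab j x) \<partial>(lborel :: (real^'n) measure))"
  proof (rule nn_integral_cong)
    fix x :: "real^'n"
    have "iter_integral ks f x = iter_integral ks f 0"
      by (rule line_invariant_all_imp_const[OF inv])
    then show "iter_integral ks f x * (slab i x * (\<Prod>j\<in>UNIV - {i}. slab j x))
        = iter_integral ks f 0 * (\<Prod>j\<in>UNIV. slab j x)"
      by (simp add: prod.remove[of UNIV i "\<lambda>j. slab j x"])
  qed
  finally show ?thesis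
    by (simp add: nn_integral_cmult nn_integral_prod_slab ks_def)
qed

lemma line_integral_mono: "(\<And>x. f x \<le> g x) \<Longrightarrow> line_integral j f x \<le> line_integral j g x"
  unfolding line_integral_def by (intro nn_integral_mono)

text \<open>When direction \<open>j\<close> is integrated, factor \<open>j\<close> is constant along
  it and comes out; the other n - 1 factors carry exponents 1 / (n - 1), which sum to 1, so Hoelder
  applies. Factor \<open>i\<close> is thus integrated in every direction except \<open>i\<close>,
  hence the \<open>filter\<close>.\<close>

lemma iter_integral_prod_le:
  fixes f :: "'n::finite \<Rightarrow> real^'n \<Rightarrow> ennreal"
  assumes n: "CARD('n) \<ge> 2" and f: "\<And>i. f i \<in> borel_measurable borel" "\<And>i. line_invariant i (f i)"
    and "distinct js"
  shows "iter_integral js (\<lambda>x. \<Prod>i\<in>UNIV. epow (f i x) (1 / (real CARD('n) - 1))) x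
    \<le> (\<Prod>i\<in>UNIV. epow (iter_integral (filter (\<lambda>j. j \<noteq> i) js) (f i) x) (1 / (real CARD('n) - 1)))"
  using \<open>distinct js\<close>
proof (induction js arbitrary: x)
  case (Cons j js)
  define s where "s = 1 / (real CARD('n) - 1)"
  define h where "h i = iter_integral (filter (\<lambda>k. k \<noteq> i) js) (f i)" for i
  have [measurable]: "h i \<in> borel_measurable borel" for i
    unfolding h_def using f by measurable
  have K: "card (UNIV - {j}) = CARD('n) - 1"
    by (simp add: card_Diff_singleton)
  have Kne: "UNIV - {j} \<noteq> {}"
  proof
    assume "UNIV - {j} = {}"
    then have "card (UNIV - {j}) = 0" by (simp only: card.empty)
    with K n show False by linarith
  qed
  have s: "s = 1 / real (card (UNIV - {j}))"
    using n unfolding K s_def by (simp add: of_nat_diff)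
  have hj: "line_invariant j (h j)"
    unfolding h_def using f by (intro line_invariant_iter_integral)
  then have hjs: "line_invariant j (\<lambda>x. epow (h j x) s)"
    by (simp add: line_invariant_def)
  have eq: "filter (\<lambda>k. k \<noteq> j) (j # js) = filter (\<lambda>k. k \<noteq> j) js" by simp
  have "iter_integral (j # js) (\<lambda>x. \<Prod>i\<in>UNIV. epow (f i x) s) x \<le> line_integral j (\<lambda>x. \<Prod>i\<in>UNIV. epow (h i x) s) x"
    unfolding iter_integral_simps
    using Cons by (intro line_integral_mono) (auto simp: h_def s_def)
  also have "(\<lambda>x. \<Prod>i\<in>UNIV. epow (h i x) s) = (\<lambda>x. (\<Prod>i\<in>UNIV-{j}. epow (h i x) s) * epow (h j x) s)"
    by (simp add: prod.remove[of UNIV j] mult.commute)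
  also have "line_integral j \<dots> x = line_integral j (\<lambda>x. \<Prod>i\<in>UNIV-{j}. epow (h i x) s) x * epow (h j x) s"
    using hjs by (simp add: line_integral_mult_invariant)
  also have "line_integral j (\<lambda>x. \<Prod>i\<in>UNIV-{j}. epow (h i x) s) x \<le> (\<Prod>i\<in>UNIV-{j}. epow (line_integral j (h i) x) s)"
    unfolding line_integral_def s using Kne by (intro nn_integral_prod_epow_le) auto
  also have "(\<Prod>i\<in>UNIV-{j}. epow (line_integral j (h i) x) s) * epow (h j x) s
      = (\<Prod>i\<in>UNIV. epow (iter_integral (filter (\<lambda>k. k \<noteq> i) (j # js)) (f i) x) s)"
    unfolding prod.remove[of UNIV j, simplified] eq
    by (subst mult.commute, intro arg_cong2[where f="(*)"] prod.cong) (auto simp: h_def)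
  finally show ?case
    by (simp add: s_def mult_right_mono)
qed simp

theorem Loomis_Whitney:
  fixes f :: "'n::finite \<Rightarrow> real^'n \<Rightarrow> ennreal"
  assumes n: "CARD('n) \<ge> 2" and f: "\<And>i. f i \<in> borel_measurable borel" "\<And>i. line_invariant i (f i)"
  shows "(\<integral>\<^sup>+x. (\<Prod>i\<in>UNIV. epow (f i x) (1 / (real CARD('n) - 1))) \<partial>lborel)
    \<le> (\<Prod>i\<in>UNIV. epow (\<integral>\<^sup>+x. f i x * slab i x \<partial>lborel) (1 / (real CARD('n) - 1)))"
proof -
  obtain js where js: "distinct js" "set js = (UNIV :: 'n set)"
    using finite_distinct_list[of "UNIV :: 'n set"] by auto
  note [measurable] = f(1)
  show ?thesis
    using iter_integral_prod_le[OF n f js(1), of 0]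
    by (subst nn_integral_eq_iter_integral_all[OF _ js])
       (simp_all add: nn_integral_slab_eq_iter_integral[OF f js])
qed

section \<open>Projecting facets along coordinate directions\<close>

lemma borel_measurable_linear:
  fixes f :: "'a::euclidean_space \<Rightarrow> 'b::euclidean_space"
  shows "linear f \<Longrightarrow> f \<in> borel_measurable borel"
  by (simp add: borel_measurable_continuous_onI linear_continuous_on linear_conv_bounded_linear)

text \<open>The Fubini argument for uniqueness of Haar measure, applied to the image of \<open>w\<close> times Lebesgue
  measure under \<open>\<rho>\<close>. It replaces a determinant, which is not available for maps between
  \<open>real^'n\<close> and \<open>real^'m\<close>.\<close>

lemma nn_integral_translation_invariant_image:
  fixes \<rho> :: "'b::euclidean_space \<Rightarrow> 'a::euclidean_space" and w :: "'b \<Rightarrow> ennreal"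
  assumes [measurable]: "\<rho> \<in> borel_measurable borel" "w \<in> borel_measurable borel" "g \<in> borel_measurable borel"
    and inv: "\<And>f a. f \<in> borel_measurable borel \<Longrightarrow>
      (\<integral>\<^sup>+x. f (\<rho> x + a) * w x \<partial>lborel) = (\<integral>\<^sup>+x. f (\<rho> x) * w x \<partial>lborel)"
  shows "(\<integral>\<^sup>+x. g (\<rho> x) * w x \<partial>lborel)
    = (\<integral>\<^sup>+x. indicator (cbox 0 One) (\<rho> x) * w x \<partial>lborel) * (\<integral>\<^sup>+y. g y \<partial>lborel)"
proof -
  define f :: "'a \<Rightarrow> ennreal" where "f = indicator (cbox 0 One)"
  have [measurable]: "f \<in> borel_measurable borel"
    unfolding f_def by measurable
  have "(\<integral>\<^sup>+x. f (\<rho> x) * w x \<partial>lborel) * (\<integral>\<^sup>+y. g y \<partial>lborel)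
      = (\<integral>\<^sup>+x. (\<integral>\<^sup>+y. f (\<rho> x) * w x * g y \<partial>lborel) \<partial>lborel)"
    by (simp add: nn_integral_cmult nn_integral_multc)
  also have "\<dots> = (\<integral>\<^sup>+x. (\<integral>\<^sup>+y. f (\<rho> x) * w x * g (y + \<rho> x) \<partial>lborel) \<partial>lborel)"
    by (simp add: nn_integral_cmult nn_integral_lborel_translate)
  also have "\<dots> = (\<integral>\<^sup>+y. (\<integral>\<^sup>+x. f (\<rho> x) * w x * g (y + \<rho> x) \<partial>lborel) \<partial>lborel)"
    by (rule lborel_pair.Fubini'[symmetric]) measurable
  also have "\<dots> = (\<integral>\<^sup>+y. (\<integral>\<^sup>+x. f (\<rho> x - y) * w x * g (\<rho> x) \<partial>lborel) \<partial>lborel)"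
  proof (rule nn_integral_cong)
    fix y
    show "(\<integral>\<^sup>+x. f (\<rho> x) * w x * g (y + \<rho> x) \<partial>lborel) = (\<integral>\<^sup>+x. f (\<rho> x - y) * w x * g (\<rho> x) \<partial>lborel)"
      using inv[of "\<lambda>z. f (z - y) * g z" y] by (simp add: ac_simps)
  qed
  also have "\<dots> = (\<integral>\<^sup>+x. (\<integral>\<^sup>+y. f (\<rho> x - y) * w x * g (\<rho> x) \<partial>lborel) \<partial>lborel)"
    by (rule lborel_pair.Fubini') measurable
  also have "\<dots> = (\<integral>\<^sup>+x. w x * g (\<rho> x) \<partial>lborel)"
  proof (rule nn_integral_cong)
    fix x
    have "\<rho> x - y \<in> cbox 0 One \<longleftrightarrow> y \<in> cbox (\<rho> x - One) (\<rho> x)" for y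
      unfolding mem_box by (intro ball_cong) (auto simp: inner_diff_left)
    then have "f (\<rho> x - y) = indicator (cbox (\<rho> x - One) (\<rho> x)) y" for y
      by (simp add: f_def indicator_def)
    then have "(\<integral>\<^sup>+y. f (\<rho> x - y) \<partial>lborel) = 1"
      by (simp add: emeasure_lborel_cbox_eq inner_diff_left)
    then show "(\<integral>\<^sup>+y. f (\<rho> x - y) * w x * g (\<rho> x) \<partial>lborel) = w x * g (\<rho> x)"
      by (simp add: nn_integral_multc mult.assoc)
  qed
  finally show ?thesis
    by (simp add: f_def mult.commute)
qed

text \<open>The map \<rho> projects along axis \<open>i\<close> and reads off the parameter of the
  hyperplane. It sends Lebesgue measure on the slab to a translation invariant measure, hence to a
  multiple \<kappa> of Lebesgue measure.\<close>

lemma axis_projection: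
  fixes L :: "real^'m \<Rightarrow> real^'n" and i :: 'n
  assumes L: "linear L" "inj L" and card: "CARD('n) = Suc CARD('m)" and i: "axis i 1 \<notin> range L"
  obtains \<rho> :: "real^'n \<Rightarrow> real^'m" and \<kappa> :: real
  where "linear \<rho>" "\<And>y. \<rho> (L y) = y" "\<rho> (axis i 1) = 0" "0 \<le> \<kappa>"
    "\<And>h. h \<in> borel_measurable borel \<Longrightarrow>
       (\<integral>\<^sup>+x. h (\<rho> x) * slab i x \<partial>lborel) = ennreal \<kappa> * (\<integral>\<^sup>+y. h y \<partial>lborel)"
proof -
  \<comment> \<open>\<open>f\<close> parametrizes the whole space by the hyperplane directions and
    axis \<open>i\<close>; it is bijective because the axis is transversal and the dimensions add
    up.\<close>
  define f :: "(real^'m) \<times> real \<Rightarrow> real^'n" where "f z = L (fst z) + snd z *\<^sub>R axis i 1" for z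
  interpret L: linear L by fact
  have f: "linear f"
    unfolding f_def by (rule linearI) (auto simp: L.add L.scale algebra_simps)
  have "z = 0" if "f z = 0" for z
  proof -
    have "snd z = 0"
    proof (rule ccontr)
      assume "snd z \<noteq> 0"
      have "axis i 1 = L ((- 1 / snd z) *\<^sub>R fst z)"
        using that \<open>snd z \<noteq> 0\<close> unfolding f_def L.scale
        by (metis (no_types, lifting) add_eq_0_iff divide_minus_left inverse_eq_divide minus_minus real_vector.scale_minus_left real_vector.scale_minus_right real_vector.scale_scale real_vector.scale_one right_inverse mult.commute)
      with i show False by blast
    qed
    moreover from this that have "L (fst z) = L 0"
      by (simp add: f_def L.zero)
    then have "fst z = 0"
      using L by (simp only: inj_eq)
    ultimately show ?thesis
      by (simp add: prod_eq_iff)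
  qed
  then have "inj f"
    using f linear_injective_0 by blast
  obtain G where G: "linear G" "G \<circ> f = id"
    using linear_injective_left_inverse[OF f \<open>inj f\<close>] by blast
  have "dim (range f) = DIM(real^'n)"
    using dim_image_eq[OF f, of UNIV] \<open>inj f\<close> card by simp
  then have "span (range f) = UNIV"
    by (simp only: dim_eq_full)
  then have "surj f"
    using f by (metis linear_subspace_image span_eq_iff subspace_UNIV)
  define \<rho> where "\<rho> x = fst (G x)" for x
  have \<rho>: "linear \<rho>"
    unfolding \<rho>_def using linear_compose[OF G(1) linear_fst] by (simp add: o_def)
  interpret \<rho>: linear \<rho> by fact
  have Gf: "G (f z) = z" for z
    using G(2) by (metis comp_apply id_apply)
  have \<rho>L: "\<rho> (L y) = y" for y
    using Gf[of "(y, 0)"] by (simp add: \<rho>_def f_def)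
  have \<rho>i: "\<rho> (axis i 1) = 0"
    using Gf[of "(0, 1)"] by (simp add: \<rho>_def f_def L.zero)
  \<comment> \<open>\<open>H\<close> is injective, hence bounded below, so the part of the slab over
    the unit cube is bounded and \<kappa> is finite.\<close>
  define H where "H x = (\<rho> x, x $ i)" for x
  have H: "linear H"
    unfolding H_def by (rule linearI) (auto simp: \<rho>.add \<rho>.scale)
  have "x = 0" if "H x = 0" for x
  proof -
    obtain z where z: "x = f z"
      using \<open>surj f\<close> by blast
    have "fst z = 0"
      using that by (simp add: H_def \<rho>_def z Gf prod_eq_iff)
    then have "x = snd z *\<^sub>R axis i 1"
      by (simp add: z f_def L.zero)
    moreover have "x $ i = 0"
      using that by (simp add: H_def prod_eq_iff)
    ultimately show "x = 0"
      by (simp add: axis_def)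
  qed
  then have "inj H"
    using H linear_injective_0 by blast
  then obtain B where B: "B > 0" "\<And>x. B * norm x \<le> norm (H x)"
    using H linear_inj_bounded_below_pos by blast
  define S where "S = {x. \<rho> x \<in> cbox 0 One \<and> x $ i \<in> {0..1}}"
  obtain R where R: "\<And>y. y \<in> cbox 0 (One :: real^'m) \<Longrightarrow> norm y \<le> R"
    using bounded_cbox unfolding bounded_iff by blast
  have "norm x \<le> (R + 1) / B" if "x \<in> S" for x
  proof -
    have "norm (H x) \<le> norm (\<rho> x) + \<bar>x $ i\<bar>"
      unfolding H_def using norm_Pair_le[of "\<rho> x" "x $ i"] by simp
    also have "\<dots> \<le> R + 1"
      using that R by (intro add_mono) (auto simp: S_def)
    finally show ?thesis
      using B(1) B(2)[of x] by (simp add: field_simps)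
  qed
  then have "bounded S"
    unfolding bounded_iff by blast
  have [measurable]: "\<rho> \<in> borel_measurable borel"
    using \<rho> by (simp add: borel_measurable_linear)
  have "(\<integral>\<^sup>+x. indicator (cbox 0 One) (\<rho> x) * slab i x \<partial>lborel) = (\<integral>\<^sup>+x. indicator S x \<partial>lborel)"
    by (intro nn_integral_cong) (auto simp: S_def slab_def indicator_def)
  also have "\<dots> = emeasure lborel S"
    by (rule nn_integral_indicator) (simp add: S_def)
  also have "\<dots> < \<infinity>"
    using \<open>bounded S\<close> by (rule emeasure_bounded_finite)
  finally have fin: "(\<integral>\<^sup>+x. indicator (cbox 0 One) (\<rho> x) * slab i x \<partial>lborel) < \<infinity>" .
  define \<kappa> where "\<kappa> = enn2real (\<integral>\<^sup>+x. indicator (cbox 0 One) (\<rho> x) * slab i x \<partial>lborel)"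
  have inv: "(\<integral>\<^sup>+x. h (\<rho> x + a) * slab i x \<partial>lborel) = (\<integral>\<^sup>+x. h (\<rho> x) * slab i x \<partial>lborel)"
    if [measurable]: "h \<in> borel_measurable borel" for h a
  proof -
    \<comment> \<open>\<open>L a\<close> slid along axis \<open>i\<close> to coordinate 0:
      translating by \<open>b\<close> adds \<open>a\<close> after projection and preserves the
      slab.\<close>
    define b where "b = L a - (L a $ i) *\<^sub>R axis i 1"
    have "\<rho> b = a" "b $ i = 0"
      using \<rho>L \<rho>i by (simp_all add: b_def \<rho>.diff \<rho>.scale)
    then show ?thesis
      using nn_integral_lborel_translate[of "\<lambda>x. h (\<rho> x) * slab i x" b]
      by (simp add: \<rho>.add slab_def)
  qed
  show ?thesis
  proof (rule that[of \<rho> \<kappa>])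
    fix h :: "real^'m \<Rightarrow> ennreal"
    assume [measurable]: "h \<in> borel_measurable borel"
    have "ennreal \<kappa> = (\<integral>\<^sup>+x. indicator (cbox 0 One) (\<rho> x) * slab i x \<partial>lborel)"
      using fin by (simp add: \<kappa>_def)
    then show "(\<integral>\<^sup>+x. h (\<rho> x) * slab i x \<partial>lborel) = ennreal \<kappa> * (\<integral>\<^sup>+y. h y \<partial>lborel)"
      using nn_integral_translation_invariant_image[of \<rho> "slab i" h] inv by simp
  qed (use \<rho> \<rho>L \<rho>i in \<open>auto simp: \<kappa>_def\<close>)
qed

text \<open>\<open>boundary_measure\<close> prescribes only the measures of the sets
  \<open>A \<inter> F\<close>. These identify \<open>sg\<close> restricted to \<open>F\<close> with
  an image measure, which gives the formula for functions.\<close>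

lemma nn_integral_facet:
  fixes L :: "real^'m \<Rightarrow> real^'n" and sg :: "(real^'n) measure"
  assumes sg [simp]: "sets sg = sets borel" and "linear L" and F [measurable]: "F \<in> sets borel" and [measurable]: "u \<in> borel_measurable borel"
    and eq: "\<forall>A\<in>sets borel. emeasure sg (A \<inter> F) = ennreal c * emeasure lborel {y. p + L y \<in> A \<inter> F}"
  shows "(\<integral>\<^sup>+x\<in>F. u x \<partial>sg) = ennreal c * (\<integral>\<^sup>+y. u (p + L y) * indicator F (p + L y) \<partial>lborel)"
proof -
  have [measurable]: "L \<in> borel_measurable borel"
    using \<open>linear L\<close> by (simp add: borel_measurable_linear)
  have [measurable_cong]: "sets sg = sets borel" by fact
  define D where "D = density lborel (\<lambda>y. ennreal c * indicator F (p + L y))"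
  have "density sg (indicator F) = distr D borel (\<lambda>y. p + L y)"
  proof (rule measure_eqI)
    fix A assume "A \<in> sets (density sg (indicator F))"
    then have A [measurable]: "A \<in> sets borel" by simp
    have "emeasure (density sg (indicator F)) A = (\<integral>\<^sup>+x. indicator F x * indicator A x \<partial>sg)"
      using sg by (intro emeasure_density) auto
    also have "\<dots> = (\<integral>\<^sup>+x. indicator (A \<inter> F) x \<partial>sg)"
      by (simp only: indicator_inter_arith mult.commute)
    also have "\<dots> = emeasure sg (A \<inter> F)"
      by (rule nn_integral_indicator) simp
    also have "\<dots> = ennreal c * emeasure lborel {y. p + L y \<in> A \<inter> F}"
      using eq by simp
    also have "emeasure lborel {y. p + L y \<in> A \<inter> F} = (\<integral>\<^sup>+y. indicator {y. p + L y \<in> A \<inter> F} y \<partial>lborel)"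
      by (rule nn_integral_indicator[symmetric]) measurable
    also have "ennreal c * \<dots> = (\<integral>\<^sup>+y. ennreal c * indicator {y. p + L y \<in> A \<inter> F} y \<partial>lborel)"
      by (rule nn_integral_cmult[symmetric]) measurable
    also have "\<dots> = (\<integral>\<^sup>+y. ennreal c * indicator F (p + L y) * indicator {y. p + L y \<in> A} y \<partial>lborel)"
      by (intro nn_integral_cong) (simp add: indicator_def)
    also have "\<dots> = emeasure D {y. p + L y \<in> A}"
      unfolding D_def by (rule emeasure_density[symmetric]) measurable
    also have "\<dots> = emeasure (distr D borel (\<lambda>y. p + L y)) A"
      by (subst emeasure_distr) (auto simp: D_def vimage_def)
    finally show "emeasure (density sg (indicator F)) A = emeasure (distr D borel (\<lambda>y. p + L y)) A" .
  qed simp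
  moreover have "(\<integral>\<^sup>+x\<in>F. u x \<partial>sg) = (\<integral>\<^sup>+x. u x \<partial>density sg (indicator F))"
    by (subst nn_integral_density) (auto simp: mult.commute)
  moreover have "(\<integral>\<^sup>+x. u x \<partial>distr D borel (\<lambda>y. p + L y)) = (\<integral>\<^sup>+y. u (p + L y) \<partial>D)"
    by (rule nn_integral_distr) (auto simp: D_def)
  moreover have "\<dots> = (\<integral>\<^sup>+y. ennreal c * (u (p + L y) * indicator F (p + L y)) \<partial>lborel)"
    unfolding D_def by (subst nn_integral_density) (auto simp: ac_simps)
  ultimately show ?thesis
    by (simp add: nn_integral_cmult)
qed

text \<open>The supporting hyperplane that cuts out \<open>F\<close> contains its affine hull and
  misses the interior.\<close>

lemma interior_Int_affine_hull_facet:
  fixes P :: "'a::euclidean_space set"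
  assumes "polyhedron P" "F facet_of P"
  shows "interior P \<inter> affine hull F = {}"
proof -
  obtain a b where ab: "a \<noteq> 0" "P \<subseteq> {x. a \<bullet> x \<le> b}" "F = P \<inter> {x. a \<bullet> x = b}"
    using assms by (rule facet_of_polyhedron)
  have "interior P \<subseteq> {x. a \<bullet> x < b}"
    using interior_mono[OF ab(2)] ab(1) by (simp add: interior_halfspace_le)
  moreover have "affine hull F \<subseteq> {x. a \<bullet> x = b}"
    using ab(3) by (intro hull_minimal) (auto simp: affine_hyperplane)
  ultimately show ?thesis
    by fastforce
qed

text \<open>A trace estimate with a constant uniform in \<open>u\<close>. The bound \<open>g\<close>
  is \<open>u\<close> on \<open>S\<close> spread along axis \<open>i\<close>, kept as an invariant
  function because Loomis--Whitney takes such functions.\<close>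

definition trace_bound :: "(real^'n) set \<Rightarrow> (real^'n) set \<Rightarrow> (real^'n) measure \<Rightarrow> 'n \<Rightarrow> real \<Rightarrow> bool" where
  "trace_bound P S sg i C \<longleftrightarrow> 0 \<le> C \<and>
    (\<forall>u\<in>borel_measurable borel. \<exists>g\<in>borel_measurable borel. line_invariant i g \<and>
      (\<forall>x\<in>interior P. \<forall>s. x + s *\<^sub>R axis i 1 \<in> S \<longrightarrow> u (x + s *\<^sub>R axis i 1) \<le> g x) \<and>
      (\<integral>\<^sup>+x. g x * slab i x \<partial>lborel) \<le> ennreal C * (\<integral>\<^sup>+x\<in>S. u x \<partial>sg))"

text \<open>Either the facet is parallel to axis \<open>i\<close>, and no such line through the
  interior meets it, or projection along the axis identifies its hyperplane with
  \<open>real^'m\<close> up to a constant factor between the measures.\<close>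

lemma facet_trace:
  fixes P :: "(real^'n) set"
  assumes bm: "boundary_measure TYPE('m::finite) P sg" and card: "CARD('n) = Suc CARD('m)"
    and P: "polyhedron P" "F facet_of P"
  shows "\<exists>C. trace_bound P F sg i C"
proof -
  obtain c p and L :: "real^'m \<Rightarrow> real^'n" where c: "c > 0" and L: "linear L" "inj L"
    and aff: "(\<lambda>y. p + L y) ` UNIV = affine hull F"
    and eq: "\<forall>A\<in>sets borel. emeasure sg (A \<inter> F) = ennreal c * emeasure lborel {y. p + L y \<in> A \<inter> F}"
    using bm P(2) unfolding boundary_measure_def by metis
  have sg: "sets sg = sets borel"
    using bm by (simp add: boundary_measure_def)
  have F [measurable]: "F \<in> sets borel"
    using P by (intro borel_closed) (meson face_of_imp_closed facet_of_imp_face_of polyhedron_imp_closed polyhedron_imp_convex)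
  interpret L: linear L by fact
  have [measurable]: "L \<in> borel_measurable borel"
    using L by (simp add: borel_measurable_linear)
  have sub: "F \<subseteq> range (\<lambda>y. p + L y)"
    using aff hull_subset[of F affine] by simp
  show ?thesis
  proof (cases "axis i 1 \<in> range L")
    case True
    then obtain y where y: "axis i 1 = L y" by blast
    have no: "x + s *\<^sub>R axis i 1 \<notin> F" if "x \<in> interior P" for x s
    proof
      assume "x + s *\<^sub>R axis i 1 \<in> F"
      with sub obtain z where "x + s *\<^sub>R axis i 1 = p + L z" by blast
      then have "x = p + L (z - s *\<^sub>R y)"
        by (simp add: L.diff L.scale y algebra_simps)
      then have "x \<in> affine hull F"
        unfolding aff[symmetric] by blast
      with that interior_Int_affine_hull_facet[OF P] show False
        by blast
    qed
    show ?thesis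
      unfolding trace_bound_def
      by (intro exI[of _ 0] conjI ballI bexI[of _ "\<lambda>_. 0"]) (use no in \<open>auto simp: line_invariant_def\<close>)
  next
    case False
    obtain \<rho> :: "real^'n \<Rightarrow> real^'m" and \<kappa> :: real where \<rho>: "linear \<rho>" "\<And>y. \<rho> (L y) = y" "\<rho> (axis i 1) = 0" "0 \<le> \<kappa>"
      and int: "\<And>h. h \<in> borel_measurable borel \<Longrightarrow>
       (\<integral>\<^sup>+x. h (\<rho> x) * slab i x \<partial>lborel) = ennreal \<kappa> * (\<integral>\<^sup>+y. h y \<partial>lborel)"
      using axis_projection[OF L card False] by blast
    interpret \<rho>: linear \<rho> by fact
    have [measurable]: "\<rho> \<in> borel_measurable borel"
      using \<rho>(1) by (simp add: borel_measurable_linear)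
    show ?thesis
      unfolding trace_bound_def
    \<comment> \<open>\<kappa> is the density of the projected slab measure and \<open>c\<close>
      that of \<open>sg\<close> on the facet, both relative to Lebesgue measure in the
      parameter.\<close>
    proof (intro exI[of _ "\<kappa> / c"] conjI ballI)
      fix u :: "real^'n \<Rightarrow> ennreal"
      assume [measurable]: "u \<in> borel_measurable borel"
      define v where "v x = u x * indicator F x" for x
      have [measurable]: "v \<in> borel_measurable borel"
        unfolding v_def by measurable
      \<comment> \<open>The axis line through \<open>x\<close> meets the hyperplane at parameter
        \<open>\<rho> x - \<rho> p\<close>; \<open>v\<close> is zero if this point is off
        \<open>F\<close>.\<close>
      define g where "g x = v (p + L (\<rho> x - \<rho> p))" for x
      have inv: "line_invariant i g"
        by (simp add: line_invariant_def g_def \<rho>.add \<rho>.scale \<rho>(3))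
      have le: "u (x + s *\<^sub>R axis i 1) \<le> g x" if F: "x + s *\<^sub>R axis i 1 \<in> F" for x s
      proof -
        obtain y where y: "x + s *\<^sub>R axis i 1 = p + L y"
          using F sub by blast
        have "\<rho> (x + s *\<^sub>R axis i 1) = \<rho> (p + L y)"
          by (simp only: y)
        then have "\<rho> x - \<rho> p = y"
          by (simp add: \<rho>.add \<rho>.scale \<rho>(2,3))
        then show ?thesis
          using F by (simp add: g_def v_def y)
      qed
      have "(\<integral>\<^sup>+x. g x * slab i x \<partial>lborel) = ennreal \<kappa> * (\<integral>\<^sup>+y. v (p + L (y + (- \<rho> p))) \<partial>lborel)"
        unfolding g_def using int[of "\<lambda>y. v (p + L (y - \<rho> p))"] by simp
      also have "(\<integral>\<^sup>+y. v (p + L (y + (- \<rho> p))) \<partial>lborel) = (\<integral>\<^sup>+y. v (p + L y) \<partial>lborel)"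
        by (rule nn_integral_lborel_translate[of "\<lambda>y. v (p + L y)"]) measurable
      also have "ennreal \<kappa> * \<dots> = ennreal (\<kappa> / c) * (ennreal c * (\<integral>\<^sup>+y. v (p + L y) \<partial>lborel))"
        using c \<rho>(4) by (simp add: mult.assoc[symmetric] flip: ennreal_mult)
      also have "\<dots> = ennreal (\<kappa> / c) * (\<integral>\<^sup>+x\<in>F. u x \<partial>sg)"
        by (subst nn_integral_facet[OF sg L(1) _ _ eq]) (auto simp: v_def)
      finally have "(\<integral>\<^sup>+x. g x * slab i x \<partial>lborel) \<le> ennreal (\<kappa> / c) * (\<integral>\<^sup>+x\<in>F. u x \<partial>sg)"
        by simp
      moreover have "g \<in> borel_measurable borel"
        unfolding g_def by measurable
      ultimately show "\<exists>g\<in>borel_measurable borel. line_invariant i g \<and>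
          (\<forall>x\<in>interior P. \<forall>s. x + s *\<^sub>R axis i 1 \<in> F \<longrightarrow> u (x + s *\<^sub>R axis i 1) \<le> g x) \<and>
          (\<integral>\<^sup>+x. g x * slab i x \<partial>lborel) \<le> ennreal (\<kappa> / c) * (\<integral>\<^sup>+x\<in>F. u x \<partial>sg)"
        using inv le by blast
    qed (use c \<rho>(4) in auto)
  qed
qed

text \<open>Sum over the finitely many facets: wherever a line leaves the polytope, the summand of
  the facet it hits already dominates \<open>u\<close>.\<close>

lemma boundary_trace:
  fixes P :: "(real^'n) set"
  assumes bm: "boundary_measure TYPE('m::finite) P sg" and card: "CARD('n) = Suc CARD('m)"
    and P: "polyhedron P" "interior P \<noteq> {}"
  shows "\<exists>C. trace_bound P (frontier P) sg i C"
proof -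
  define \<F> where "\<F> = {F. F facet_of P}"
  have fin: "finite \<F>"
    unfolding \<F>_def using P by (intro finite_polyhedron_facets)
  have fr: "frontier P = \<Union>\<F>"
    using P rel_frontier_of_polyhedron[of P] rel_frontier_nonempty_interior[of P] by (simp add: \<F>_def)
  obtain C where C: "\<And>F. F \<in> \<F> \<Longrightarrow> trace_bound P F sg i (C F)"
    using facet_trace[OF bm card P(1), of _ i] unfolding \<F>_def by (metis mem_Collect_eq)
  then have C0: "\<And>F. F \<in> \<F> \<Longrightarrow> 0 \<le> C F"
    by (simp add: trace_bound_def)
  show ?thesis
    unfolding trace_bound_def
  proof (intro exI[of _ "\<Sum>F\<in>\<F>. C F"] conjI ballI)
    fix u :: "real^'n \<Rightarrow> ennreal"
    assume u: "u \<in> borel_measurable borel"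
    obtain g where g: "\<And>F. F \<in> \<F> \<Longrightarrow> g F \<in> borel_measurable borel"
      "\<And>F. F \<in> \<F> \<Longrightarrow> line_invariant i (g F)"
      "\<And>F x s. F \<in> \<F> \<Longrightarrow> x \<in> interior P \<Longrightarrow> x + s *\<^sub>R axis i 1 \<in> F \<Longrightarrow> u (x + s *\<^sub>R axis i 1) \<le> g F x"
      "\<And>F. F \<in> \<F> \<Longrightarrow> (\<integral>\<^sup>+x. g F x * slab i x \<partial>lborel) \<le> ennreal (C F) * (\<integral>\<^sup>+x\<in>F. u x \<partial>sg)"
    proof -
      have "\<forall>F\<in>\<F>. \<exists>g. g \<in> borel_measurable borel \<and> line_invariant i g \<and>
        (\<forall>x\<in>interior P. \<forall>s. x + s *\<^sub>R axis i 1 \<in> F \<longrightarrow> u (x + s *\<^sub>R axis i 1) \<le> g x) \<and>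
        (\<integral>\<^sup>+x. g x * slab i x \<partial>lborel) \<le> ennreal (C F) * (\<integral>\<^sup>+x\<in>F. u x \<partial>sg)"
        using C u unfolding trace_bound_def by blast
      from bchoice[OF this] show ?thesis
        using that by blast
    qed
    note [measurable] = g(1)
    have "(\<integral>\<^sup>+x. (\<Sum>F\<in>\<F>. g F x) * slab i x \<partial>lborel) = (\<Sum>F\<in>\<F>. \<integral>\<^sup>+x. g F x * slab i x \<partial>lborel)"
      by (simp add: sum_distrib_right nn_integral_sum)
    also have "\<dots> \<le> (\<Sum>F\<in>\<F>. ennreal (C F) * (\<integral>\<^sup>+x\<in>frontier P. u x \<partial>sg))"
    proof (rule sum_mono)
      fix F assume F: "F \<in> \<F>"
      have "(\<integral>\<^sup>+x\<in>F. u x \<partial>sg) \<le> (\<integral>\<^sup>+x\<in>frontier P. u x \<partial>sg)"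
        using F fr by (intro nn_integral_mono) (auto simp: indicator_def)
      with g(4)[OF F] show "(\<integral>\<^sup>+x. g F x * slab i x \<partial>lborel) \<le> ennreal (C F) * (\<integral>\<^sup>+x\<in>frontier P. u x \<partial>sg)"
        by (meson mult_left_mono order_trans zero_le)
    qed
    also have "\<dots> = ennreal (\<Sum>F\<in>\<F>. C F) * (\<integral>\<^sup>+x\<in>frontier P. u x \<partial>sg)"
      using C0 by (simp add: sum_distrib_right flip: sum_ennreal)
    finally have int: "(\<integral>\<^sup>+x. (\<Sum>F\<in>\<F>. g F x) * slab i x \<partial>lborel) \<le> ennreal (\<Sum>F\<in>\<F>. C F) * (\<integral>\<^sup>+x\<in>frontier P. u x \<partial>sg)" .
    have le: "u (x + s *\<^sub>R axis i 1) \<le> (\<Sum>F\<in>\<F>. g F x)" if x: "x \<in> interior P" and xs: "x + s *\<^sub>R axis i 1 \<in> frontier P" for x s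
    proof -
      obtain F where F: "F \<in> \<F>" "x + s *\<^sub>R axis i 1 \<in> F"
        using xs unfolding fr by (elim UnionE)
      have "u (x + s *\<^sub>R axis i 1) \<le> g F x"
        by (rule g(3)[OF F(1) x F(2)])
      also have "\<dots> \<le> (\<Sum>F\<in>\<F>. g F x)"
        using F fin by (intro member_le_sum) auto
      finally show ?thesis .
    qed
    have "line_invariant i (\<lambda>x. \<Sum>F\<in>\<F>. g F x)"
      using g(2) by (simp add: line_invariant_def)
    with int le show "\<exists>g\<in>borel_measurable borel. line_invariant i g \<and>
        (\<forall>x\<in>interior P. \<forall>s. x + s *\<^sub>R axis i 1 \<in> frontier P \<longrightarrow> u (x + s *\<^sub>R axis i 1) \<le> g x) \<and>
        (\<integral>\<^sup>+x. g x * slab i x \<partial>lborel) \<le> ennreal (\<Sum>F\<in>\<F>. C F) * (\<integral>\<^sup>+x\<in>frontier P. u x \<partial>sg)"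
      by (intro bexI[of _ "\<lambda>x. \<Sum>F\<in>\<F>. g F x"]) auto
  qed (use C0 in \<open>auto intro: sum_nonneg\<close>)
qed

text \<open>Convexity enters as the maximum bound on segments, so that one \<open>g i\<close> covers
  both ends of an axis line. The constant is the product of the trace constants, each to the power 1
  / (n - 1).\<close>

theorem trace_inequality:
  fixes P :: "(real^'n) set"
  assumes n: "CARD('n) \<ge> 2" and bm: "boundary_measure TYPE('m::finite) P sg" and card: "CARD('n) = Suc CARD('m)"
    and P: "polyhedron P" "interior P \<noteq> {}" "bounded P"
  shows "\<exists>C\<ge>0. \<forall>u\<in>borel_measurable borel. \<forall>B\<ge>0.
    (\<forall>x\<in>P. \<forall>y\<in>P. \<forall>z\<in>closed_segment x y. u z \<le> max (u x) (u y)) \<longrightarrow>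
    (\<integral>\<^sup>+x\<in>frontier P. u x \<partial>sg) \<le> ennreal B \<longrightarrow>
    (\<integral>\<^sup>+x\<in>interior P. epow (u x) (real CARD('n) / (real CARD('n) - 1)) \<partial>lborel)
      \<le> ennreal (C * B powr (real CARD('n) / (real CARD('n) - 1)))"
proof -
  define s where "s = 1 / (real CARD('n) - 1)"
  define p where "p = real CARD('n) / (real CARD('n) - 1)"
  have s: "s > 0" "p > 0" "p = real CARD('n) * s"
    using n by (simp_all add: s_def p_def)
  obtain C where "\<And>i. trace_bound P (frontier P) sg i (C i)"
  proof -
    have "\<forall>i. \<exists>C. trace_bound P (frontier P) sg i C"
      using boundary_trace[OF bm card P(1,2)] by blast
    from choice[OF this] show ?thesis
      using that by blast
  qed
  then have C: "C i \<ge> 0" "\<And>u. u \<in> borel_measurable borel \<Longrightarrow> \<exists>g. g \<in> borel_measurable borel \<and> line_invariant i g \<and>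
    (\<forall>x\<in>interior P. \<forall>s. x + s *\<^sub>R axis i 1 \<in> frontier P \<longrightarrow> u (x + s *\<^sub>R axis i 1) \<le> g x) \<and>
    (\<integral>\<^sup>+x. g x * slab i x \<partial>lborel) \<le> ennreal (C i) * (\<integral>\<^sup>+x\<in>frontier P. u x \<partial>sg)" for i
    unfolding trace_bound_def by blast+
  have "(\<integral>\<^sup>+x\<in>interior P. epow (u x) p \<partial>lborel) \<le> ennreal ((\<Prod>i\<in>UNIV. C i powr s) * B powr p)"
    if u [measurable]: "u \<in> borel_measurable borel" and "B \<ge> 0"
      and qc: "\<And>x y z. x \<in> P \<Longrightarrow> y \<in> P \<Longrightarrow> z \<in> closed_segment x y \<Longrightarrow> u z \<le> max (u x) (u y)"
      and uB: "(\<integral>\<^sup>+x\<in>frontier P. u x \<partial>sg) \<le> ennreal B" for u B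
  proof -
    obtain g where [measurable]: "\<And>i. g i \<in> borel_measurable borel"
      and g: "\<And>i. line_invariant i (g i)"
      "\<And>i x s. x \<in> interior P \<Longrightarrow> x + s *\<^sub>R axis i 1 \<in> frontier P \<Longrightarrow> u (x + s *\<^sub>R axis i 1) \<le> g i x"
      "\<And>i. (\<integral>\<^sup>+x. g i x * slab i x \<partial>lborel) \<le> ennreal (C i) * (\<integral>\<^sup>+x\<in>frontier P. u x \<partial>sg)"
    proof -
      have "\<forall>i. \<exists>g. g \<in> borel_measurable borel \<and> line_invariant i g \<and>
        (\<forall>x\<in>interior P. \<forall>s. x + s *\<^sub>R axis i 1 \<in> frontier P \<longrightarrow> u (x + s *\<^sub>R axis i 1) \<le> g x) \<and>
        (\<integral>\<^sup>+x. g x * slab i x \<partial>lborel) \<le> ennreal (C i) * (\<integral>\<^sup>+x\<in>frontier P. u x \<partial>sg)"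
        using C(2)[OF u] by blast
      from choice[OF this] show ?thesis
        using that by blast
    qed
    have ug: "u x \<le> g i x" if x: "x \<in> interior P" for x i
    proof -
      obtain d where d: "0 < d" "x + d *\<^sub>R axis i 1 \<in> frontier P"
        using ray_to_frontier[OF P(3) x, of "axis i 1"] by (metis axis_eq_0_iff zero_neq_one)
      obtain e where e: "0 < e" "x + e *\<^sub>R (- axis i 1) \<in> frontier P"
        using ray_to_frontier[OF P(3) x, of "- axis i 1"] by (metis axis_eq_0_iff neg_equal_0_iff_equal zero_neq_one)
      have P': "frontier P \<subseteq> P"
        using P(1) frontier_subset_closed polyhedron_imp_closed by blast
      \<comment> \<open>The weight \<open>d / (d + e)\<close> balances the steps \<open>d\<close>
        and \<open>- e\<close> along the axis.\<close>
      have "x = (1 - d / (d + e)) *\<^sub>R (x + d *\<^sub>R axis i 1) + (d / (d + e)) *\<^sub>R (x + (- e) *\<^sub>R axis i 1)"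
      proof -
        have "(1 - d / (d + e)) * d + (d / (d + e)) * (- e) = 0"
          using d(1) e(1) by (simp add: field_simps)
        moreover have "(1 - d / (d + e)) *\<^sub>R (x + d *\<^sub>R axis i 1) + (d / (d + e)) *\<^sub>R (x + (- e) *\<^sub>R axis i 1)
            = x + ((1 - d / (d + e)) * d + (d / (d + e)) * (- e)) *\<^sub>R axis i 1"
          by (simp only: scaleR_add_right scaleR_diff_left scaleR_add_left scaleR_scaleR) simp
        ultimately show ?thesis by simp
      qed
      moreover have "0 \<le> d / (d + e)" "d / (d + e) \<le> 1"
        using d(1) e(1) by simp_all
      ultimately have "x \<in> closed_segment (x + d *\<^sub>R axis i 1) (x + (- e) *\<^sub>R axis i 1)"
        unfolding closed_segment_def by blast
      then have "u x \<le> max (u (x + d *\<^sub>R axis i 1)) (u (x + (- e) *\<^sub>R axis i 1))"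
        using d e P' by (intro qc) auto
      also have "\<dots> \<le> g i x"
        using g(2)[OF x d(2)] g(2)[OF x, of "- e" i] e(2) by simp
      finally show ?thesis .
    qed
    have "(\<integral>\<^sup>+x\<in>interior P. epow (u x) p \<partial>lborel) \<le> (\<integral>\<^sup>+x. (\<Prod>i\<in>UNIV. epow (g i x) s) \<partial>lborel)"
    proof (rule nn_integral_mono)
      fix x
      show "epow (u x) p * indicator (interior P) x \<le> (\<Prod>i\<in>UNIV. epow (g i x) s)"
      proof (cases "x \<in> interior P")
        case True
        \<comment> \<open>As \<open>p\<close> is n times \<open>s\<close>, the power splits into one
          factor per direction, each bounded by its own \<open>g i\<close>.\<close>
        have "epow (u x) p = (\<Prod>i\<in>(UNIV :: 'n set). epow (u x) s)"
        proof (cases "u x")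
          case (real r)
          then show ?thesis
            using s by (cases "r = 0") (simp_all add: epow_ennreal ennreal_power powr_power mult.commute)
        next
          case top
          then show ?thesis
            using s by (simp add: top_power_ennreal)
        qed
        also have "\<dots> \<le> (\<Prod>i\<in>UNIV. epow (g i x) s)"
          using ug[OF True] s by (intro prod_mono_ennreal epow_mono) auto
        finally show ?thesis
          using True by simp
      qed simp
    qed
    also have "\<dots> \<le> (\<Prod>i\<in>UNIV. epow (\<integral>\<^sup>+x. g i x * slab i x \<partial>lborel) s)"
      using Loomis_Whitney[OF n, of g] g(1) by (simp add: s_def)
    also have "\<dots> \<le> (\<Prod>i\<in>UNIV. epow (ennreal (C i * B)) s)"
    proof (intro prod_mono_ennreal epow_mono)
      fix i
      have "(\<integral>\<^sup>+x. g i x * slab i x \<partial>lborel) \<le> ennreal (C i) * ennreal B"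
        using g(3)[of i] uB by (meson mult_left_mono order_trans zero_le)
      then show "(\<integral>\<^sup>+x. g i x * slab i x \<partial>lborel) \<le> ennreal (C i * B)"
        using C(1) \<open>B \<ge> 0\<close> by (simp add: ennreal_mult)
    qed (use s in auto)
    also have "\<dots> = (\<Prod>i\<in>UNIV. ennreal (C i powr s * B powr s))"
      using s C(1) \<open>B \<ge> 0\<close> by (simp add: epow_ennreal powr_mult)
    also have "\<dots> = ennreal ((\<Prod>i\<in>UNIV. C i powr s) * B powr p)"
      using \<open>B \<ge> 0\<close> s by (cases "B = 0") (simp_all add: prod_ennreal prod.distrib powr_power mult.commute)
    finally show ?thesis .
  qed
  then show ?thesis
    unfolding p_def[symmetric] by (intro exI[of _ "\<Prod>i\<in>UNIV. C i powr s"]) (auto intro!: prod_nonneg)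
qed

section \<open>Lower semicontinuity and log-convexity\<close>

lemma epow_add: "0 \<le> s \<Longrightarrow> 0 \<le> t \<Longrightarrow> epow a (s + t) = epow a s * epow a t"
  by (cases a; cases "s = 0"; cases "t = 0")
     (auto simp: epow_def powr_add ennreal_mult ennreal_top_mult)

lemma epow_exp: "epow (ennreal (exp a)) s = ennreal (exp (s * a))"
  by (simp add: epow_def powr_def)

text \<open>Superlevel sets are relatively open. \<open>Liminf\<close> ignores the value at the
  point itself, which is in the set by choice.\<close>

lemma lsc_on_imp_measurable:
  assumes "lsc_on P u"
  shows "u \<in> borel_measurable (restrict_space borel P)"
proof (rule borel_measurableI_greater)
  fix a
  have "openin (top_of_set P) {x \<in> P. a < u x}"
  proof (subst openin_subopen, safe)
    fix x assume x: "x \<in> P" "a < u x"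
    then have "a < Liminf (at x within P) u"
      using assms by (auto simp: lsc_on_def intro: less_le_trans)
    then have "eventually (\<lambda>y. a < u y) (at x within P)"
      by (rule less_LiminfD)
    then obtain T where T: "open T" "x \<in> T" "\<And>y. y \<in> T \<Longrightarrow> y \<noteq> x \<Longrightarrow> y \<in> P \<Longrightarrow> a < u y"
      unfolding eventually_at_topological by blast
    show "\<exists>T. openin (top_of_set P) T \<and> x \<in> T \<and> T \<subseteq> {x \<in> P. a < u x}"
      using T x by (intro exI[of _ "P \<inter> T"]) (auto simp: openin_open_Int)
  qed
  then obtain T where "open T" "{x \<in> P. a < u x} = P \<inter> T"
    by (auto simp: openin_open)
  then show "{x \<in> space (restrict_space borel P). a < u x} \<in> sets (restrict_space borel P)"
    by (auto simp: space_restrict_space sets_restrict_space)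
qed

lemma lsc_on_SUP_continuous:
  assumes "\<And>t. t \<in> I \<Longrightarrow> continuous_on P (f t)"
  shows "lsc_on P (\<lambda>x. SUP t\<in>I. f t x)"
  unfolding lsc_on_def
proof (intro ballI SUP_least)
  fix x t assume x: "x \<in> P" and t: "t \<in> I"
  show "f t x \<le> Liminf (at x within P) (\<lambda>x. SUP t\<in>I. f t x)"
  \<comment> \<open>At an isolated point of \<open>P\<close> the filter is \<open>bot\<close> and
    its \<open>Liminf\<close> is \<open>top\<close>.\<close>
  proof (cases "at x within P = bot")
    case False
    have "(f t \<longlongrightarrow> f t x) (at x within P)"
      using assms[OF t] x by (simp add: continuous_on)
    then have "f t x = Liminf (at x within P) (f t)"
      using False by (simp add: lim_imp_Liminf)
    also have "\<dots> \<le> Liminf (at x within P) (\<lambda>x. SUP t\<in>I. f t x)"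
      using t by (intro Liminf_mono always_eventually allI SUP_upper)
    finally show ?thesis .
  qed simp
qed

text \<open>Replace both values by their maximum; the exponents \<open>1 - t\<close> and
  \<open>t\<close> then recombine to 1.\<close>

lemma log_convex_on_le_max:
  assumes "log_convex_on P u" "x \<in> P" "y \<in> P" "z \<in> closed_segment x y"
  shows "u z \<le> max (u x) (u y)"
proof -
  obtain t where t: "0 \<le> t" "t \<le> 1" "z = (1 - t) *\<^sub>R x + t *\<^sub>R y"
    using assms(4) by (auto simp: closed_segment_def)
  have "u z \<le> epow (u x) (1 - t) * epow (u y) t"
    using assms t by (auto simp: log_convex_on_def)
  also have "\<dots> \<le> epow (max (u x) (u y)) (1 - t) * epow (max (u x) (u y)) t"
    using t by (intro mult_mono epow_mono) auto
  also have "\<dots> = max (u x) (u y)"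
    using t by (simp flip: epow_add)
  finally show ?thesis .
qed

lemma nn_integral_lborel_reflect:
  fixes f :: "'a::euclidean_space \<Rightarrow> ennreal"
  assumes "f \<in> borel_measurable borel"
  shows "(\<integral>\<^sup>+x. f (a - x) \<partial>lborel) = (\<integral>\<^sup>+x. f x \<partial>lborel)"
proof -
  have "(\<integral>\<^sup>+x. f x \<partial>lborel) = (\<integral>\<^sup>+x. f x \<partial>density (distr lborel borel (\<lambda>x. a + (-1) *\<^sub>R x)) (\<lambda>_. ennreal (\<bar>-1\<bar> ^ DIM('a))))"
    using lborel_affine[of "-1" a] by simp
  also have "\<dots> = (\<integral>\<^sup>+x. f (a - x) \<partial>lborel)"
    using assms by (subst nn_integral_density) (auto simp: nn_integral_distr)
  finally show ?thesis ..
qed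

text \<open>Of two points opposite each other about \<open>x\<close>, one has value at least
  \<open>v x\<close>. Integrating \<open>v (x + h) + v (x - h)\<close> over the ball counts the
  integral of \<open>v\<close> at most twice.\<close>

lemma quasiconvex_interior_bound:
  fixes v :: "'a::euclidean_space \<Rightarrow> ennreal"
  assumes [measurable]: "v \<in> borel_measurable borel"
    and qc: "\<And>y z. y \<in> ball x d \<Longrightarrow> z \<in> ball x d \<Longrightarrow> x \<in> closed_segment y z \<Longrightarrow> v x \<le> max (v y) (v z)"
  shows "v x * emeasure lborel (ball (0::'a) d) \<le> 2 * (\<integral>\<^sup>+y. v y \<partial>lborel)"
proof -
  have "v x * emeasure lborel (ball (0::'a) d) = (\<integral>\<^sup>+h. v x * indicator (ball (0::'a) d) h \<partial>lborel)"
    by (rule nn_integral_cmult_indicator[symmetric]) simp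
  also have "\<dots> \<le> (\<integral>\<^sup>+h. v (h + x) + v (x - h) \<partial>lborel)"
  proof (rule nn_integral_mono)
    fix h :: 'a
    show "v x * indicator (ball 0 d) h \<le> v (h + x) + v (x - h)"
    proof (cases "h \<in> ball 0 d")
      case True
      have "x = (1 - 1/2) *\<^sub>R (h + x) + (1/2) *\<^sub>R (x - h)"
        by (simp add: algebra_simps flip: scaleR_left_distrib)
      then have "x \<in> closed_segment (h + x) (x - h)"
        unfolding closed_segment_def by (intro CollectI exI[of _ "1/2"]) auto
      then have "v x \<le> max (v (h + x)) (v (x - h))"
        using True by (intro qc) (auto simp: dist_norm norm_minus_commute)
      also have "\<dots> \<le> v (h + x) + v (x - h)"
        by (simp add: max_def)
      finally show ?thesis using True by simp
    qed simp
  qed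
  also have "\<dots> = (\<integral>\<^sup>+h. v (h + x) \<partial>lborel) + (\<integral>\<^sup>+h. v (x - h) \<partial>lborel)"
    by (rule nn_integral_add) auto
  also have "\<dots> = 2 * (\<integral>\<^sup>+y. v y \<partial>lborel)"
    by (simp add: nn_integral_lborel_translate nn_integral_lborel_reflect mult_2)
  finally show ?thesis .
qed

section \<open>Compactness of locally bounded convex functions\<close>

text \<open>A Lipschitz bound depending only on \<open>M\<close> and \<open>d\<close>, hence uniform
  over a family with a common bound. Extend the segment from \<open>x\<close> through
  \<open>y\<close> to length \<open>d / 2\<close>, and likewise from \<open>y\<close> through
  \<open>x\<close>; convexity on each gives one sign of the difference.\<close>

lemma convex_on_diff_le:
  fixes f :: "'a::real_normed_vector \<Rightarrow> real"
  assumes f: "convex_on S f" and d: "ball x d \<subseteq> S" and M: "\<And>z. z \<in> ball x d \<Longrightarrow> 0 \<le> f z \<and> f z \<le> M"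
    and y: "dist x y < d / 2"
  shows "\<bar>f y - f x\<bar> \<le> 2 * M / d * dist x y"
proof (cases "y = x")
  case False
  define r where "r = norm (y - x)"
  have r: "0 < r" "r < d / 2" "dist x y = r"
    using y False by (auto simp: r_def dist_norm norm_minus_commute)
  define l where "l = 2 * r / d"
  have l: "0 \<le> l" "l \<le> 1"
    using r by (auto simp: l_def field_simps)
  define e where "e = (d / (2 * r)) *\<^sub>R (y - x)"
  have le: "l *\<^sub>R e = y - x"
    using r by (simp add: l_def e_def)
  have ne: "norm e = d / 2"
    using r by (simp add: e_def flip: r_def)
  have z1: "x + e \<in> ball x d"
    using ne r by (simp add: dist_norm)
  have "dist x (y - e) = norm ((1 - d / (2 * r)) *\<^sub>R (y - x))"
    by (simp add: e_def dist_norm norm_minus_commute algebra_simps)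
  also have "\<dots> = \<bar>1 - d / (2 * r)\<bar> * r"
    by (simp add: r_def)
  also have "\<dots> = d / 2 - r"
    using r by (simp add: abs_if field_simps)
  finally have z2: "y - e \<in> ball x d"
    using r by simp
  have xS: "x \<in> ball x d" "y \<in> ball x d"
    using r by auto
  have "f ((1 - l) *\<^sub>R x + l *\<^sub>R (x + e)) \<le> (1 - l) * f x + l * f (x + e)"
    using f l z1 xS d by (intro convex_onD) auto
  moreover have "(1 - l) *\<^sub>R x + l *\<^sub>R (x + e) = y"
    by (simp add: algebra_simps le)
  ultimately have "f y - f x \<le> l * (f (x + e) - f x)"
    by (simp add: algebra_simps)
  also have "\<dots> \<le> l * M"
    using M[OF z1] M[OF xS(1)] l by (intro mult_left_mono) auto
  finally have 1: "f y - f x \<le> l * M" .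
  have "f ((1 - l) *\<^sub>R y + l *\<^sub>R (y - e)) \<le> (1 - l) * f y + l * f (y - e)"
    using f l z2 xS d by (intro convex_onD) auto
  moreover have "(1 - l) *\<^sub>R y + l *\<^sub>R (y - e) = x"
    by (simp add: algebra_simps le)
  ultimately have "f x - f y \<le> l * (f (y - e) - f y)"
    by (simp add: algebra_simps)
  also have "\<dots> \<le> l * M"
    using M[OF z2] M[OF xS(2)] l by (intro mult_left_mono) auto
  finally have "f x - f y \<le> l * M" .
  with 1 show ?thesis
    by (simp add: l_def r(3) abs_if ac_simps)
qed simp

text \<open>A diagonal subsequence converges on a countable dense set; the common local Lipschitz
  bound carries the Cauchy property to every point of \<open>S\<close>.\<close>

theorem convex_functions_convergent_subsequence:
  fixes f :: "nat \<Rightarrow> 'a::euclidean_space \<Rightarrow> real"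
  assumes f: "\<And>n. convex_on S (f n)" and nonneg: "\<And>n x. x \<in> S \<Longrightarrow> 0 \<le> f n x"
    and bdd: "\<And>x. x \<in> S \<Longrightarrow> \<exists>d>0. \<exists>M. ball x d \<subseteq> S \<and> (\<forall>n. \<forall>y\<in>ball x d. f n y \<le> M)"
  obtains k :: "nat \<Rightarrow> nat" where "strict_mono k" "\<And>x. x \<in> S \<Longrightarrow> convergent (\<lambda>n. f (k n) x)"
proof -
  obtain D where D: "countable D" "D \<subseteq> S" "S \<subseteq> closure D"
    using separable by blast
  have "\<forall>x\<in>S. \<exists>M. \<forall>n. f n x \<le> M"
    using bdd by (meson centre_in_ball)
  then obtain M where M: "\<And>x n. x \<in> S \<Longrightarrow> f n x \<le> M x"
    using bchoice[of S "\<lambda>x M. \<forall>n. f n x \<le> M"] by blast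
  have M0: "0 \<le> M x" if "x \<in> S" for x
    using M[OF that, of 0] nonneg[OF that, of 0] by linarith
  \<comment> \<open>Dividing by \<open>M x + 1\<close> gives the single bound 1 that the diagonal
    argument asks for.\<close>
  obtain k :: "nat \<Rightarrow> nat" where k: "strict_mono k"
    "\<And>x. x \<in> D \<Longrightarrow> \<exists>l. (\<lambda>n. f (k n) x / (M x + 1)) \<longlonglongrightarrow> l"
  proof (rule function_convergent_subsequence[of D "\<lambda>n x. f n x / (M x + 1)" 1])
    fix n x assume "x \<in> D"
    with D have "x \<in> S" by blast
    then show "norm (f n x / (M x + 1)) \<le> 1"
      using M[of x n] M0[of x] nonneg[of x n] by simp
  qed (use D in blast)+
  have conv: "convergent (\<lambda>n. f (k n) q)" if q: "q \<in> D" for q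
  proof -
    have "q \<in> S" using q D by blast
    then have "M q + 1 \<noteq> 0" using M0[of q] by linarith
    moreover obtain l where "(\<lambda>n. f (k n) q / (M q + 1)) \<longlonglongrightarrow> l"
      using k(2)[OF q] by blast
    from tendsto_mult_right[OF this, of "M q + 1"] have "(\<lambda>n. f (k n) q / (M q + 1) * (M q + 1)) \<longlonglongrightarrow> l * (M q + 1)" .
    ultimately show ?thesis
      by (auto simp: convergent_def)
  qed
  have "convergent (\<lambda>n. f (k n) x)" if x: "x \<in> S" for x
  proof -
    obtain d M where d: "d > 0" "ball x d \<subseteq> S" "\<And>n y. y \<in> ball x d \<Longrightarrow> f n y \<le> M"
      using bdd[OF x] by blast
    have "0 \<le> M"
      using d(3)[of x 0] d(1) nonneg[OF x, of 0] by simp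
    have "Cauchy (\<lambda>n. f (k n) x)"
    proof (rule metric_CauchyI)
      fix e :: real assume e: "e > 0"
      \<comment> \<open>Within \<open>d / 2\<close> the Lipschitz bound holds, and the second term
        keeps the change below \<open>e / 3\<close>; \<open>M + 1\<close> avoids a zero
        denominator.\<close>
      define \<delta> where "\<delta> = min (d / 2) (e * d / (6 * (M + 1)))"
      have "\<delta> > 0"
        using d(1) e \<open>0 \<le> M\<close> by (simp add: \<delta>_def)
      then obtain q where q: "q \<in> D" "dist q x < \<delta>"
        using D(3) x by (meson closure_approachable subsetD)
      have small: "\<bar>f n q - f n x\<bar> < e / 3" for n
      proof -
        have "\<bar>f n q - f n x\<bar> \<le> 2 * M / d * dist x q"
        proof (rule convex_on_diff_le[OF f d(2)])
          show "dist x q < d / 2"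
            using q(2) by (simp add: \<delta>_def dist_commute)
        qed (use d nonneg in auto)
        also have "\<dots> \<le> 2 * (M + 1) / d * dist x q"
          using d(1) by (intro mult_right_mono divide_right_mono) auto
        also have "\<dots> < 2 * (M + 1) / d * (e * d / (6 * (M + 1)))"
          using q(2) d(1) \<open>0 \<le> M\<close> by (intro mult_strict_left_mono) (auto simp: \<delta>_def dist_commute)
        also have "\<dots> = e / 3"
        proof -
          have "2 * m / d * (e * d / (6 * m)) = e / 3" if "m > 0" for m
            using that d(1) by (simp add: field_simps)
          from this[of "M + 1"] show ?thesis
            using \<open>0 \<le> M\<close> by simp
        qed
        finally show ?thesis .
      qed
      have "Cauchy (\<lambda>n. f (k n) q)"
        using conv[OF q(1)] by (rule convergent_Cauchy)
      then obtain N where N: "\<And>m n. m \<ge> N \<Longrightarrow> n \<ge> N \<Longrightarrow> dist (f (k m) q) (f (k n) q) < e / 3"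
        using e unfolding Cauchy_def by (metis divide_pos_pos zero_less_numeral)
      have "dist (f (k m) x) (f (k n) x) < e" if "m \<ge> N" "n \<ge> N" for m n
        using N[OF that] small[of "k m"] small[of "k n"] unfolding dist_real_def by linarith
      then show "\<exists>N. \<forall>m\<ge>N. \<forall>n\<ge>N. dist (f (k m) x) (f (k n) x) < e"
        by blast
    qed
    then show ?thesis
      by (simp add: Cauchy_convergent_iff)
  qed
  with k(1) show ?thesis
    using that by blast
qed

section \<open>Uniform integrability\<close>

text \<open>Beyond some \<open>X\<close> the power wins; on the compact interval up to
  \<open>X\<close> continuity gives the constant.\<close>

lemma bound_of_little_o:
  fixes g :: "real \<Rightarrow> real"
  assumes g: "continuous_on {0..} g" and lim: "((\<lambda>x. g x / x powr p) \<longlongrightarrow> 0) at_top" and e: "e > 0"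
  obtains K where "0 \<le> K" "\<And>x. 0 \<le> x \<Longrightarrow> \<bar>g x\<bar> \<le> e * x powr p + K"
proof -
  have "eventually (\<lambda>x. \<bar>g x / x powr p\<bar> < e) at_top"
    using tendstoD[OF lim e] by simp
  then have "eventually (\<lambda>x. \<bar>g x\<bar> \<le> e * x powr p) at_top"
    using eventually_gt_at_top[of 0]
    by eventually_elim (auto simp: field_simps)
  then obtain X where X: "\<And>x. x \<ge> X \<Longrightarrow> \<bar>g x\<bar> \<le> e * x powr p"
    by (auto simp: eventually_at_top_linorder)
  have "compact (g ` {0..X})"
    using g by (intro compact_continuous_image continuous_on_subset[OF g]) auto
  then have "bounded (g ` {0..X})"
    by (rule compact_imp_bounded)
  then obtain K where "\<forall>x\<in>{0..X}. \<bar>g x\<bar> \<le> K"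
    by (auto simp: bounded_iff)
  then have K: "\<And>x. x \<in> {0..X} \<Longrightarrow> \<bar>g x\<bar> \<le> K"
    by blast
  have "\<bar>g x\<bar> \<le> e * x powr p + max 0 K" if "0 \<le> x" for x
  proof (cases "x \<ge> X")
    case True
    with X[of x] show ?thesis by simp
  next
    case False
    with that have "\<bar>g x\<bar> \<le> K" by (intro K) auto
    moreover have "0 \<le> e * x powr p"
      using e by simp
    ultimately show ?thesis by linarith
  qed
  then show ?thesis
    using that[of "max 0 K"] by simp
qed

text \<open>Vitali's argument: the differences truncated at \<open>2 * K\<close> converge by
  dominated convergence, and what is cut off is at most a small multiple of the \<open>p\<close>-th
  powers, whose integrals are bounded.\<close>

theorem (in finite_measure) integral_convergence_of_bounded_power:
  fixes f :: "nat \<Rightarrow> 'a \<Rightarrow> real" and g :: "real \<Rightarrow> real"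
  assumes f [measurable]: "\<And>n. f n \<in> borel_measurable M" and w [measurable]: "w \<in> borel_measurable M"
    and nonneg: "\<And>n x. x \<in> space M \<Longrightarrow> 0 \<le> f n x" "\<And>x. x \<in> space M \<Longrightarrow> 0 \<le> w x"
    and lim: "\<And>x. x \<in> space M \<Longrightarrow> (\<lambda>n. f n x) \<longlonglongrightarrow> w x"
    and C: "\<And>n. (\<integral>\<^sup>+x. ennreal (f n x powr p) \<partial>M) \<le> ennreal C" and p: "p > 0"
    and g: "continuous_on {0..} g" and glim: "((\<lambda>x. g x / x powr p) \<longlongrightarrow> 0) at_top"
  shows "(\<integral>\<^sup>+x. ennreal (w x powr p) \<partial>M) \<le> ennreal C"
    and "\<And>n. integrable M (\<lambda>x. g (f n x))" and "integrable M (\<lambda>x. g (w x))"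
    and "(\<lambda>n. \<integral>x. g (f n x) \<partial>M) \<longlonglongrightarrow> (\<integral>x. g (w x) \<partial>M)"
proof -
  have "(\<integral>\<^sup>+x. ennreal (w x powr p) \<partial>M) = (\<integral>\<^sup>+x. liminf (\<lambda>n. ennreal (f n x powr p)) \<partial>M)"
  proof (rule nn_integral_cong)
    fix x assume x: "x \<in> space M"
    have "(\<lambda>n. f n x powr p) \<longlonglongrightarrow> w x powr p"
      using lim[OF x] p nonneg(1)[OF x] by (intro tendsto_powr') auto
    then have "(\<lambda>n. ennreal (f n x powr p)) \<longlonglongrightarrow> ennreal (w x powr p)"
      by (rule tendsto_ennrealI)
    then show "ennreal (w x powr p) = liminf (\<lambda>n. ennreal (f n x powr p))"
      by (intro lim_imp_Liminf[symmetric]) simp_all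
  qed
  also have "\<dots> \<le> liminf (\<lambda>n. \<integral>\<^sup>+x. ennreal (f n x powr p) \<partial>M)"
    by (intro nn_integral_liminf) measurable
  also have "\<dots> \<le> liminf (\<lambda>n. ennreal C)"
    using C by (intro Liminf_mono always_eventually allI)
  also have "\<dots> = ennreal C"
    by (simp add: Liminf_const)
  finally show wC: "(\<integral>\<^sup>+x. ennreal (w x powr p) \<partial>M) \<le> ennreal C" .
  have int_powr: "integrable M (\<lambda>x. h x powr p)" "(\<integral>x. h x powr p \<partial>M) \<le> max 0 C"
    if [measurable]: "h \<in> borel_measurable M" and h: "(\<integral>\<^sup>+x. ennreal (h x powr p) \<partial>M) \<le> ennreal C" for h
  proof -
    show "integrable M (\<lambda>x. h x powr p)"
      using h by (intro integrableI_nonneg) (auto intro: le_less_trans)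
    then show "(\<integral>x. h x powr p \<partial>M) \<le> max 0 C"
      using h by (simp add: nn_integral_eq_integral ennreal_le_iff2) (auto simp: max_def)
  qed
  \<comment> \<open>\<open>g\<close> is controlled only on nonnegative arguments; \<open>G\<close>
    extends it continuously to the line, for measurability.\<close>
  define G where "G x = g (max 0 x)" for x
  have "continuous_on UNIV G"
    unfolding G_def by (rule continuous_on_compose2[OF g]) (auto intro!: continuous_intros)
  then have [measurable]: "G \<in> borel_measurable borel"
    by (rule borel_measurable_continuous_onI)
  have gG: "g (h x) = G (h x)" if "0 \<le> h x" for h :: "'a \<Rightarrow> real" and x
    using that by (simp add: G_def)
  have gm: "(\<lambda>x. g (h x)) \<in> borel_measurable M"
    if [measurable]: "h \<in> borel_measurable M" and "\<And>x. x \<in> space M \<Longrightarrow> 0 \<le> h x" for h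
  proof -
    have "(\<lambda>x. G (h x)) \<in> borel_measurable M"
      by measurable
    then show ?thesis
      using that(2) by (subst measurable_cong[of _ _ "\<lambda>x. G (h x)"]) (auto simp: gG)
  qed
  have gint: "integrable M (\<lambda>x. g (h x))"
    if h [measurable]: "h \<in> borel_measurable M" and h0: "\<And>x. x \<in> space M \<Longrightarrow> 0 \<le> h x"
      and hC: "(\<integral>\<^sup>+x. ennreal (h x powr p) \<partial>M) \<le> ennreal C" for h
  proof -
    obtain K where K: "0 \<le> K" "\<And>x. 0 \<le> x \<Longrightarrow> \<bar>g x\<bar> \<le> 1 * x powr p + K"
      using bound_of_little_o[OF g glim zero_less_one] by metis
    show ?thesis
    proof (rule Bochner_Integration.integrable_bound)
      show "integrable M (\<lambda>x. h x powr p + K)"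
        using int_powr(1)[OF h hC] by simp
      show "AE x in M. norm (g (h x)) \<le> norm (h x powr p + K)"
        using K h0 by (intro AE_I2) (simp add: abs_of_nonneg)
    qed (use gm[OF h h0] in auto)
  qed
  show fi: "integrable M (\<lambda>x. g (f n x))" for n
    using gint[OF f nonneg(1) C] .
  show wi: "integrable M (\<lambda>x. g (w x))"
    using gint[OF w nonneg(2) wC] .
  show "(\<lambda>n. \<integral>x. g (f n x) \<partial>M) \<longlonglongrightarrow> (\<integral>x. g (w x) \<partial>M)"
  proof (rule tendstoI)
    fix e :: real assume "e > 0"
    define C' where "C' = max 0 C + 1"
    have C': "C' > 0" "max 0 C < C'"
      by (auto simp: C'_def)
    \<comment> \<open>The cut-off part costs at most \<open>\<epsilon> * (C' + C')\<close>, which is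
      \<open>e / 2\<close>; the other half of \<open>e\<close> is left for the truncated
      part.\<close>
    define \<epsilon> where "\<epsilon> = e / (4 * C')"
    have \<epsilon>: "\<epsilon> > 0"
      using \<open>e > 0\<close> C' by (simp add: \<epsilon>_def)
    obtain K where K: "0 \<le> K" "\<And>x. 0 \<le> x \<Longrightarrow> \<bar>g x\<bar> \<le> \<epsilon> * x powr p + K"
      using bound_of_little_o[OF g glim \<epsilon>] by metis
    define D where "D n x = \<bar>g (f n x) - g (w x)\<bar>" for n x
    have Di: "integrable M (D n)" for n
      unfolding D_def using fi wi by simp
    have Dm [measurable]: "D n \<in> borel_measurable M" for n
      using Di by (rule borel_measurable_integrable)
    have mint: "integrable M (\<lambda>x. min (D n x) (2 * K))" for n
    proof (rule Bochner_Integration.integrable_bound[OF Di[of n]])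
      show "AE x in M. norm (min (D n x) (2 * K)) \<le> norm (D n x)"
        using K(1) by (simp add: D_def)
    qed simp
    have Dlim: "(\<lambda>n. D n x) \<longlonglongrightarrow> 0" if x: "x \<in> space M" for x
    proof -
      have "(\<lambda>n. g (f n x)) \<longlonglongrightarrow> g (w x)"
        using g lim[OF x] nonneg x by (intro continuous_on_tendsto_compose[OF g]) auto
      then show ?thesis
        unfolding D_def using LIM_zero tendsto_rabs_zero by blast
    qed
    have "(\<lambda>n. \<integral>x. min (D n x) (2 * K) \<partial>M) \<longlonglongrightarrow> (\<integral>x. 0 \<partial>M)"
    proof (rule integral_dominated_convergence[where w = "\<lambda>_. 2 * K"])
      show "AE x in M. (\<lambda>n. min (D n x) (2 * K)) \<longlonglongrightarrow> 0"
      proof (rule AE_I2)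
        fix x assume "x \<in> space M"
        from tendsto_min[OF Dlim[OF this] tendsto_const[of "2 * K"]]
        show "(\<lambda>n. min (D n x) (2 * K)) \<longlonglongrightarrow> 0"
          using K(1) by simp
      qed
      show "AE x in M. norm (min (D n x) (2 * K)) \<le> 2 * K" for n
        using K(1) by (intro AE_I2) (simp add: D_def)
    qed simp_all
    then have "eventually (\<lambda>n. (\<integral>x. min (D n x) (2 * K) \<partial>M) < e / 2) sequentially"
      using \<open>e > 0\<close> by (intro order_tendstoD(2)[of _ 0]) simp_all
    then show "eventually (\<lambda>n. dist (\<integral>x. g (f n x) \<partial>M) (\<integral>x. g (w x) \<partial>M) < e) sequentially"
    proof eventually_elim
      case (elim n)
      have fp: "integrable M (\<lambda>x. f n x powr p)" "(\<integral>x. f n x powr p \<partial>M) \<le> max 0 C"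
        using int_powr[OF f C] by auto
      have wp: "integrable M (\<lambda>x. w x powr p)" "(\<integral>x. w x powr p \<partial>M) \<le> max 0 C"
        using int_powr[OF w wC] by auto
      have "dist (\<integral>x. g (f n x) \<partial>M) (\<integral>x. g (w x) \<partial>M) = \<bar>\<integral>x. g (f n x) - g (w x) \<partial>M\<bar>"
        using fi wi by (simp add: dist_real_def)
      also have "\<dots> \<le> (\<integral>x. D n x \<partial>M)"
        unfolding D_def by (rule integral_abs_bound)
      also have "\<dots> \<le> (\<integral>x. min (D n x) (2 * K) + \<epsilon> * (f n x powr p + w x powr p) \<partial>M)"
      proof (rule integral_mono)
        fix x assume x: "x \<in> space M"
        \<comment> \<open>The two constants \<open>K\<close> add up to the truncation level
          \<open>2 * K\<close>.\<close>
        have "D n x \<le> (\<epsilon> * f n x powr p + K) + (\<epsilon> * w x powr p + K)"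
          using K(2)[OF nonneg(1)[OF x, of n]] K(2)[OF nonneg(2)[OF x]] unfolding D_def by linarith
        moreover have "0 \<le> \<epsilon> * (f n x powr p + w x powr p)"
          using \<epsilon> by simp
        ultimately show "D n x \<le> min (D n x) (2 * K) + \<epsilon> * (f n x powr p + w x powr p)"
          by (auto simp: min_def distrib_left)
      qed (use Di mint fp wp in auto)
      also have "\<dots> = (\<integral>x. min (D n x) (2 * K) \<partial>M) + \<epsilon> * ((\<integral>x. f n x powr p \<partial>M) + (\<integral>x. w x powr p \<partial>M))"
        using mint fp wp by simp
      also have "\<dots> < e / 2 + \<epsilon> * (C' + C')"
        using elim fp wp \<epsilon> C' by (intro add_strict_mono mult_strict_left_mono) auto
      also have "\<dots> = e"
        using C' by (simp add: \<epsilon>_def)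
      finally show ?case .
    qed
  qed
qed

section \<open>Extending a log-convex function to the boundary\<close>

text \<open>By log-convexity the quotients below increase with \<open>t\<close>; they are continuous in \<open>x\<close>, so their
  supremum is lower semicontinuous, and it is the radial limit at boundary points.\<close>

definition radial_quotient :: "(real^'n \<Rightarrow> real) \<Rightarrow> real^'n \<Rightarrow> real \<Rightarrow> real^'n \<Rightarrow> real" where
  "radial_quotient \<phi> c t x = (\<phi> ((1 - t) *\<^sub>R c + t *\<^sub>R x) - (1 - t) * \<phi> c) / t"

definition radial_extension :: "(real^'n \<Rightarrow> real) \<Rightarrow> real^'n \<Rightarrow> real^'n \<Rightarrow> ennreal" where
  "radial_extension \<phi> c x = (SUP t\<in>{0<..<1}. ennreal (exp (radial_quotient \<phi> c t x)))"

context
  fixes P :: "(real^'n) set" and \<phi> :: "real^'n \<Rightarrow> real" and c :: "real^'n"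
  assumes P: "convex P" and c: "c \<in> interior P" and \<phi>: "convex_on (interior P) \<phi>"
begin

lemma radial_point_interior:
  assumes "x \<in> P" "0 < t" "t < 1"
  shows "(1 - t) *\<^sub>R c + t *\<^sub>R x \<in> interior P"
  using mem_interior_convex_shrink[OF P c assms(1), of "1 - t"] assms
  by (simp add: algebra_simps)

lemma lsc_on_radial_extension: "lsc_on P (radial_extension \<phi> c)"
proof -
  have cont: "continuous_on (interior P) \<phi>"
    using \<phi> by (intro convex_on_continuous) auto
  have "continuous_on P (\<lambda>x. ennreal (exp (radial_quotient \<phi> c t x)))" if "t \<in> {0<..<1}" for t
    unfolding radial_quotient_def using that radial_point_interior
    by (intro continuous_on_ennreal continuous_intros continuous_on_compose2[OF cont]) auto
  then show ?thesis
    unfolding radial_extension_def by (intro lsc_on_SUP_continuous)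
qed

text \<open>For fixed \<open>t\<close> the quotient is convex in \<open>x\<close>, coming from
  \<phi> composed with an affine map; log-convexity then survives the supremum over
  \<open>t\<close>.\<close>

lemma log_convex_on_radial_extension: "log_convex_on P (radial_extension \<phi> c)"
  unfolding log_convex_on_def
proof (intro ballI allI impI)
  fix x y and l :: real assume x: "x \<in> P" and y: "y \<in> P" and l: "0 \<le> l \<and> l \<le> 1"
  show "radial_extension \<phi> c ((1 - l) *\<^sub>R x + l *\<^sub>R y)
    \<le> epow (radial_extension \<phi> c x) (1 - l) * epow (radial_extension \<phi> c y) l"
    unfolding radial_extension_def[of \<phi> c "(1 - l) *\<^sub>R x + l *\<^sub>R y"]
  proof (rule SUP_least)
    fix t :: real assume t: "t \<in> {0<..<1}"
    define q where "q = radial_quotient \<phi> c t"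
    have le: "ennreal (exp (q z)) \<le> radial_extension \<phi> c z" for z
      unfolding radial_extension_def q_def using t by (intro SUP_upper)
    define x' where "x' = (1 - t) *\<^sub>R c + t *\<^sub>R x"
    define y' where "y' = (1 - t) *\<^sub>R c + t *\<^sub>R y"
    define z' where "z' = (1 - t) *\<^sub>R c + t *\<^sub>R ((1 - l) *\<^sub>R x + l *\<^sub>R y)"
    have "\<phi> ((1 - l) *\<^sub>R x' + l *\<^sub>R y') \<le> (1 - l) * \<phi> x' + l * \<phi> y'"
      unfolding x'_def y'_def using l t x y radial_point_interior by (intro convex_onD[OF \<phi>]) auto
    also have "(1 - l) *\<^sub>R x' + l *\<^sub>R y' = z'"
      by (simp add: x'_def y'_def z'_def algebra_simps)
    finally have "(\<phi> z' - (1 - t) * \<phi> c) / t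
        \<le> ((1 - l) * (\<phi> x' - (1 - t) * \<phi> c) + l * (\<phi> y' - (1 - t) * \<phi> c)) / t"
      using t by (intro divide_right_mono) (auto simp: algebra_simps)
    then have "q ((1 - l) *\<^sub>R x + l *\<^sub>R y) \<le> (1 - l) * q x + l * q y"
      by (simp add: q_def radial_quotient_def x'_def y'_def z'_def add_divide_distrib)
    then have "ennreal (exp (q ((1 - l) *\<^sub>R x + l *\<^sub>R y))) \<le> ennreal (exp ((1 - l) * q x + l * q y))"
      by (intro ennreal_leI) simp
    also have "\<dots> = epow (ennreal (exp (q x))) (1 - l) * epow (ennreal (exp (q y))) l"
      by (simp add: epow_exp exp_add ennreal_mult)
    also have "\<dots> \<le> epow (radial_extension \<phi> c x) (1 - l) * epow (radial_extension \<phi> c y) l"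
      using l by (intro mult_mono epow_mono le) auto
    finally show "ennreal (exp (radial_quotient \<phi> c t ((1 - l) *\<^sub>R x + l *\<^sub>R y)))
        \<le> epow (radial_extension \<phi> c x) (1 - l) * epow (radial_extension \<phi> c y) l"
      by (simp add: q_def)
  qed
qed

lemma radial_extension_pos: "0 < radial_extension \<phi> c x"
proof -
  have "0 < ennreal (exp (radial_quotient \<phi> c (1/2) x))"
    by simp
  also have "\<dots> \<le> radial_extension \<phi> c x"
    unfolding radial_extension_def by (intro SUP_upper) simp
  finally show ?thesis .
qed

text \<open>Convexity bounds every quotient by \<open>\<phi> x\<close>; continuity at the interior
  point makes the quotients tend to it as \<open>t\<close> tends to 1.\<close>

lemma radial_extension_interior:
  assumes x: "x \<in> interior P"
  shows "radial_extension \<phi> c x = ennreal (exp (\<phi> x))"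
proof (rule antisym)
  show "radial_extension \<phi> c x \<le> ennreal (exp (\<phi> x))"
    unfolding radial_extension_def
  proof (rule SUP_least)
    fix t :: real assume t: "t \<in> {0<..<1}"
    have "\<phi> ((1 - t) *\<^sub>R c + t *\<^sub>R x) \<le> (1 - t) * \<phi> c + t * \<phi> x"
      using t x c by (intro convex_onD[OF \<phi>]) auto
    then have "radial_quotient \<phi> c t x \<le> \<phi> x"
      using t by (simp add: radial_quotient_def field_simps)
    then show "ennreal (exp (radial_quotient \<phi> c t x)) \<le> ennreal (exp (\<phi> x))"
      by (intro ennreal_leI) simp
  qed
  have "continuous_on (interior P) \<phi>"
    using \<phi> by (intro convex_on_continuous) auto
  then have cont: "isCont \<phi> x"
    using x continuous_on_interior interior_interior by metis
  have pt: "((\<lambda>t. (1 - t) *\<^sub>R c + t *\<^sub>R x) \<longlongrightarrow> (1 - 1) *\<^sub>R c + 1 *\<^sub>R x) (at_left 1)"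
    by (intro tendsto_intros)
  have "((\<lambda>t. \<phi> ((1 - t) *\<^sub>R c + t *\<^sub>R x)) \<longlongrightarrow> \<phi> x) (at_left 1)"
    using isCont_tendsto_compose[OF cont, of "\<lambda>t. (1 - t) *\<^sub>R c + t *\<^sub>R x" "at_left 1"] pt by simp
  then have "((\<lambda>t. radial_quotient \<phi> c t x) \<longlongrightarrow> (\<phi> x - (1 - 1) * \<phi> c) / 1) (at_left 1)"
    unfolding radial_quotient_def by (intro tendsto_intros) auto
  then have "((\<lambda>t. ennreal (exp (radial_quotient \<phi> c t x))) \<longlongrightarrow> ennreal (exp (\<phi> x))) (at_left 1)"
    by (intro tendsto_ennrealI tendsto_exp) simp
  moreover have "eventually (\<lambda>t. ennreal (exp (radial_quotient \<phi> c t x)) \<le> radial_extension \<phi> c x) (at_left 1)"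
    using eventually_at_left_real[of 0 1]
    by (auto simp: radial_extension_def elim!: eventually_mono intro!: SUP_upper)
  ultimately show "ennreal (exp (\<phi> x)) \<le> radial_extension \<phi> c x"
    by (intro tendsto_upperbound[of _ _ "at_left 1"]) auto
qed

text \<open>The hypothesis is the log-convexity inequality on the segment from \<open>c\<close> to
  \<open>x\<close> with value \<open>a\<close> at \<open>x\<close>. The extension thus lies below
  every value compatible with the interior, the form used to compare it with lower limits of
  sequences.\<close>

lemma radial_extension_le:
  assumes "0 < a" "\<And>t. 0 < t \<Longrightarrow> t < 1 \<Longrightarrow> exp (\<phi> ((1 - t) *\<^sub>R c + t *\<^sub>R x)) \<le> exp (\<phi> c) powr (1 - t) * a powr t"
  shows "radial_extension \<phi> c x \<le> ennreal a"
  unfolding radial_extension_def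
proof (rule SUP_least)
  fix t :: real assume t: "t \<in> {0<..<1}"
  have "exp (\<phi> ((1 - t) *\<^sub>R c + t *\<^sub>R x)) \<le> exp ((1 - t) * \<phi> c + t * ln a)"
    using assms(2)[of t] t assms(1) by (simp add: powr_def exp_add)
  then have "radial_quotient \<phi> c t x \<le> ln a"
    using t by (simp add: radial_quotient_def field_simps)
  then have "exp (radial_quotient \<phi> c t x) \<le> a"
    using assms(1) by (metis exp_le_cancel_iff exp_ln)
  then show "ennreal (exp (radial_quotient \<phi> c t x)) \<le> ennreal a"
    by (rule ennreal_leI)
qed

end

section \<open>Entropy and energy on a polytope\<close>

definition x_ln_x :: "real \<Rightarrow> real" where
  "x_ln_x x = x * ln x"

lemma continuous_on_x_ln_x: "continuous_on {0..} x_ln_x"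
  unfolding continuous_on_def
proof
  fix x :: real assume "x \<in> {0..}"
  then consider "x = 0" | "x > 0" by fastforce
  then show "(x_ln_x \<longlongrightarrow> x_ln_x x) (at x within {0..})"
  proof cases
    case 1
    have "((\<lambda>x::real. x * ln x) \<longlongrightarrow> 0) (at_right 0)"
      by real_asymp
    moreover have "at (0::real) within {0..} = at_right 0"
      by (rule at_within_nhd[of _ UNIV]) auto
    ultimately show ?thesis
      using 1 by (simp add: x_ln_x_def[abs_def])
  next
    case 2
    then have "isCont x_ln_x x"
      unfolding x_ln_x_def by (intro continuous_intros) auto
    then show ?thesis
      by (simp add: isCont_def Lim_at_imp_Lim_at_within)
  qed
qed

lemma x_ln_x_little_o: "p > 1 \<Longrightarrow> ((\<lambda>x. x_ln_x x / x powr p) \<longlongrightarrow> 0) at_top"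
  unfolding x_ln_x_def by real_asymp

lemma id_little_o: "p > (1::real) \<Longrightarrow> ((\<lambda>x. x / x powr p) \<longlongrightarrow> 0) at_top"
  by real_asymp

lemma x_ln_x_ge: "0 \<le> x \<Longrightarrow> - 1 \<le> x_ln_x x"
proof (cases "x = 0")
  case False
  assume "0 \<le> x"
  with False have x: "x > 0" by simp
  have "ln (1 / x) \<le> 1 / x - 1"
    using x by (intro ln_le_minus_one) simp
  then have "- ln x \<le> 1 / x"
    using x by (simp add: ln_div)
  then have "x * - ln x \<le> x * (1 / x)"
    using x by (intro mult_left_mono) auto
  then show ?thesis
    using x by (simp add: x_ln_x_def)
qed (simp add: x_ln_x_def)

text \<open>The tangent line of \<open>ln\<close> at \<open>A\<close>, applied to
  \<open>x powr (p - 1)\<close> and multiplied by \<open>x\<close>. The parameter is free: taken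
  comparable to the integral of the \<open>p\<close>-th power, it leaves only a logarithm of that
  integral.\<close>

lemma x_ln_x_le:
  assumes "0 \<le> x" "p > 1" "A > 0"
  shows "x_ln_x x \<le> (x powr p / A + x * ln A) / (p - 1)"
proof (cases "x = 0")
  case False
  with assms have x: "x > 0" by simp
  have "ln (x powr (p - 1) / A) \<le> x powr (p - 1) / A - 1"
    using x assms by (intro ln_le_minus_one) simp
  then have "(p - 1) * ln x \<le> x powr (p - 1) / A + ln A"
    using x assms by (simp add: ln_div ln_powr)
  then have "x * ((p - 1) * ln x) \<le> x * (x powr (p - 1) / A + ln A)"
    using x by (intro mult_left_mono) auto
  also have "\<dots> = x powr p / A + x * ln A"
    using x by (simp add: powr_diff algebra_simps)
  finally show ?thesis
    using assms by (simp add: x_ln_x_def field_simps)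
qed (simp add: x_ln_x_def)

text \<open>The logarithm of a power grows slower than any multiple of \<open>b\<close>; this lets
  the energy absorb the entropy.\<close>

lemma ln_powr_bound:
  fixes D C p e :: real
  assumes "C \<ge> 0" "p > 0" "e > 0"
  obtains K where "\<And>b. 0 \<le> b \<Longrightarrow> D * ln (1 + C * b powr p) \<le> e * b + K"
proof -
  have "continuous_on {0..} (\<lambda>b::real. b powr p)"
    using assms by (intro continuous_on_powr' continuous_intros) auto
  moreover have "\<forall>b\<in>{0..}. 1 + C * b powr p \<noteq> 0"
    using assms(1) by (auto simp: add_nonneg_eq_0_iff)
  ultimately have "continuous_on {0..} (\<lambda>b. D * ln (1 + C * b powr p))"
    by (intro continuous_on_mult continuous_on_ln continuous_on_add continuous_on_const) auto
  moreover have "((\<lambda>b. D * ln (1 + C * b powr p) / b powr 1) \<longlongrightarrow> 0) at_top"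
  proof (cases "C = 0")
    case False
    with assms have "C > 0" by simp
    with \<open>p > 0\<close> show ?thesis by real_asymp
  qed simp
  ultimately show ?thesis
  proof (rule bound_of_little_o[OF _ _ \<open>e > 0\<close>])
    fix K assume K: "\<And>b. 0 \<le> b \<Longrightarrow> \<bar>D * ln (1 + C * b powr p)\<bar> \<le> e * b powr 1 + K"
    show ?thesis
    proof (rule that[of K])
      fix b :: real assume "0 \<le> b"
      with K[of b] show "D * ln (1 + C * b powr p) \<le> e * b + K"
        by simp
    qed
  qed
qed

section \<open>Passing to the open polytope\<close>

context
  fixes P :: "(real^'n) set" and mu sg :: "(real^'n) measure"
  assumes n: "CARD('n) \<ge> 2" and card: "CARD('n) = Suc CARD('m::finite)"
    and sys: "system TYPE('m) P mu sg"
  fixes c crit :: real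
  assumes c: "c > 0" and mu: "mu = density lborel (\<lambda>_. ennreal c)"
    and crit_def: "crit = real CARD('n) / (real CARD('n) - 1)"
begin

text \<open>Integrals over \<open>P\<close> are moved to the interior, where members of
  \<open>Mp 1 P mu\<close> are finite and continuous; their values on the frontier matter for the
  energy alone.\<close>

definition "intP = restrict_space mu (interior P)"

definition "vol = measure intP (interior P)"

text \<open>The Bochner counterpart of \<open>int_ulogu\<close>, meaningful at finite boundary
  energy, where \<open>Mp1_facts\<close> gives integrability.\<close>

definition "ulogu v = (\<integral>x. x_ln_x (enn2real (v x)) \<partial>intP)"

lemma crit_gt_1: "crit > 1"
  using n by (simp add: crit_def)

lemma polytope: "polyhedron P" "compact P" "interior P \<noteq> {}" "convex P" "closed P" "frontier P \<subseteq> P"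
  using sys polyhedron_imp_convex compact_imp_closed frontier_subset_closed
  by (auto simp: system_def simple_polytope_def)

lemma boundary_sg: "boundary_measure TYPE('m) P sg" "sets sg = sets borel"
  using sys by (auto simp: system_def boundary_measure_def)

lemma sets_mu [simp, measurable_cong]: "sets mu = sets borel" "space mu = UNIV"
  unfolding mu by simp_all

lemma space_intP [simp]: "space intP = interior P"
  by (simp add: intP_def space_restrict_space)

lemma measurable_intP:
  "f \<in> borel_measurable (restrict_space borel (interior P)) \<Longrightarrow> f \<in> borel_measurable intP"
  unfolding intP_def by (subst measurable_cong_sets[OF sets_restrict_space_cong refl]) auto

text \<open>The frontier of a convex set is Lebesgue null.\<close>

lemma nn_integral_P: "(\<integral>\<^sup>+x\<in>P. f x \<partial>mu) = (\<integral>\<^sup>+x. f x \<partial>intP)"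
proof -
  have "frontier P \<in> null_sets lborel"
    using negligible_convex_frontier[OF polytope(4)]
    by (simp add: negligible_iff_null_sets null_sets_completion_iff)
  then have "AE x in lborel. x \<notin> frontier P"
    by (rule AE_not_in)
  then have "AE x in mu. x \<notin> frontier P"
    unfolding mu by (subst AE_density) auto
  then have "(\<integral>\<^sup>+x\<in>P. f x \<partial>mu) = (\<integral>\<^sup>+x\<in>interior P. f x \<partial>mu)"
    by (intro nn_integral_cong_AE, eventually_elim)
       (use polytope(5) interior_subset[of P] in \<open>auto simp: indicator_def frontier_def\<close>)
  also have "\<dots> = (\<integral>\<^sup>+x. f x \<partial>intP)"
    unfolding intP_def by (rule nn_integral_restrict_space[symmetric]) simp
  finally show ?thesis .
qed

lemma nn_integral_lborel_P:
  assumes [measurable]: "(\<lambda>x. f x * indicator P x) \<in> borel_measurable borel"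
  shows "(\<integral>\<^sup>+x. f x \<partial>intP) = ennreal c * (\<integral>\<^sup>+x\<in>P. f x \<partial>lborel)"
    and "(\<integral>\<^sup>+x. f x \<partial>intP) = ennreal c * (\<integral>\<^sup>+x\<in>interior P. f x \<partial>lborel)"
proof -
  have "(\<lambda>x. f x * indicator P x * indicator (interior P) x) \<in> borel_measurable borel"
    by measurable
  moreover have "f x * indicator P x * indicator (interior P) x = f x * indicator (interior P) x" for x
    using interior_subset[of P] by (auto simp: indicator_def)
  ultimately have [measurable]: "(\<lambda>x. f x * indicator (interior P) x) \<in> borel_measurable borel"
    by simp
  have "(\<integral>\<^sup>+x\<in>P. f x \<partial>mu) = ennreal c * (\<integral>\<^sup>+x\<in>P. f x \<partial>lborel)"
    unfolding mu by (subst nn_integral_density) (simp_all add: nn_integral_cmult)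
  then show "(\<integral>\<^sup>+x. f x \<partial>intP) = ennreal c * (\<integral>\<^sup>+x\<in>P. f x \<partial>lborel)"
    by (simp add: nn_integral_P)
  have "(\<integral>\<^sup>+x. f x \<partial>intP) = (\<integral>\<^sup>+x\<in>interior P. f x \<partial>mu)"
    unfolding intP_def by (rule nn_integral_restrict_space) simp
  also have "\<dots> = ennreal c * (\<integral>\<^sup>+x\<in>interior P. f x \<partial>lborel)"
    unfolding mu by (subst nn_integral_density) (simp_all add: nn_integral_cmult)
  finally show "(\<integral>\<^sup>+x. f x \<partial>intP) = ennreal c * (\<integral>\<^sup>+x\<in>interior P. f x \<partial>lborel)" .
qed

lemma emeasure_P: "emeasure mu P = emeasure intP (interior P)"
proof -
  have "emeasure mu P = (\<integral>\<^sup>+x\<in>P. 1 \<partial>mu)"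
    using polytope(5) by simp
  also have "\<dots> = emeasure intP (interior P)"
    unfolding nn_integral_P by simp
  finally show ?thesis .
qed

lemma vol_facts: "vol > 0" "emeasure mu P = ennreal vol" and finite_intP: "finite_measure intP"
proof -
  have eq: "emeasure intP (interior P) = ennreal c * emeasure lborel (interior P)"
  proof -
    have "emeasure intP (interior P) = emeasure mu (interior P)"
      unfolding intP_def by (subst emeasure_restrict_space) simp_all
    also have "\<dots> = ennreal c * emeasure lborel (interior P)"
      unfolding mu by (subst emeasure_density) (simp_all add: nn_integral_cmult)
    finally show ?thesis .
  qed
  have "bounded (interior P)"
    using polytope(2) bounded_interior compact_imp_bounded by blast
  then have "emeasure lborel (interior P) < \<infinity>"
    by (rule emeasure_bounded_finite)
  then have fin: "emeasure intP (interior P) < \<infinity>"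
    by (simp add: eq ennreal_mult_less_top)
  then show "finite_measure intP"
    by (intro finite_measureI) simp
  have "\<not> negligible (interior P)"
    using polytope(3) by (intro open_not_negligible) auto
  then have "emeasure lborel (interior P) \<noteq> 0"
    by (simp add: negligible_iff_null_sets null_sets_completion_iff null_sets_def)
  then have "emeasure intP (interior P) \<noteq> 0"
    using c by (simp add: eq)
  with fin show "vol > 0"
    unfolding vol_def measure_def by (simp add: enn2real_positive_iff less_top zero_less_iff_neq_zero)
  show "emeasure mu P = ennreal vol"
    using fin by (simp add: emeasure_P vol_def measure_def)
qed

section \<open>A priori bounds for normalized log-convex functions\<close>

lemma Mp1_iff:
  "v \<in> Mp 1 P mu \<longleftrightarrow> lsc_on P v \<and> log_convex_on P v \<and> (\<forall>x\<in>P. 0 < v x) \<and> (\<integral>\<^sup>+x. v x \<partial>intP) = ennreal vol"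
  by (auto simp: Mp_def nn_integral_P vol_facts)

lemma lsc_measurable:
  assumes "lsc_on P v"
  shows "(\<lambda>x. v x * indicator P x) \<in> borel_measurable borel"
  using lsc_on_imp_measurable[OF assms] polytope(5)
  by (subst (asm) borel_measurable_restrict_space_iff_ennreal) auto

lemma lsc_measurable_frontier:
  assumes "lsc_on P v"
  shows "(\<lambda>x. v x * indicator (frontier P) x) \<in> borel_measurable sg"
proof -
  note [measurable] = lsc_measurable[OF assms]
  have "(\<lambda>x. v x * indicator P x * indicator (frontier P) x) \<in> borel_measurable borel"
    by measurable
  moreover have "v x * indicator P x * indicator (frontier P) x = v x * indicator (frontier P) x" for x
    using polytope(6) by (auto simp: indicator_def)
  ultimately have "(\<lambda>x. v x * indicator (frontier P) x) \<in> borel_measurable borel"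
    by simp
  then show ?thesis
    by (simp add: measurable_cong_sets[OF boundary_sg(2) refl])
qed

lemma power_integral_bound:
  "\<exists>C\<ge>0. \<forall>v B. lsc_on P v \<longrightarrow> log_convex_on P v \<longrightarrow> 0 \<le> B \<longrightarrow> (\<integral>\<^sup>+x\<in>frontier P. v x \<partial>sg) \<le> ennreal B \<longrightarrow>
      (\<integral>\<^sup>+x. epow (v x) crit \<partial>intP) \<le> ennreal (C * B powr crit)"
proof -
  obtain C where C: "C \<ge> 0" "\<forall>u\<in>borel_measurable borel. \<forall>B\<ge>0.
    (\<forall>x\<in>P. \<forall>y\<in>P. \<forall>z\<in>closed_segment x y. u z \<le> max (u x) (u y)) \<longrightarrow>
    (\<integral>\<^sup>+x\<in>frontier P. u x \<partial>sg) \<le> ennreal B \<longrightarrow>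
    (\<integral>\<^sup>+x\<in>interior P. epow (u x) crit \<partial>lborel) \<le> ennreal (C * B powr crit)"
    using trace_inequality[OF n boundary_sg(1) card polytope(1,3) compact_imp_bounded[OF polytope(2)], folded crit_def]
    by (elim exE conjE) (rule that)
  show ?thesis
  proof (intro exI[of _ "c * C"] conjI allI impI)
    fix v :: "real^'n \<Rightarrow> ennreal" and B :: real
    assume v: "lsc_on P v" "log_convex_on P v" and B: "0 \<le> B" "(\<integral>\<^sup>+x\<in>frontier P. v x \<partial>sg) \<le> ennreal B"
    \<comment> \<open>Extension by zero is Borel on the whole space, and the segment condition
      survives because it concerns points of \<open>P\<close> only.\<close>
    define u where "u x = v x * indicator P x" for x
    have [measurable]: "u \<in> borel_measurable borel"
      unfolding u_def using v by (intro lsc_measurable)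
    have "u z \<le> max (u x) (u y)" if "x \<in> P" "y \<in> P" "z \<in> closed_segment x y" for x y z
    proof -
      have "z \<in> P"
        using that polytope(4) closed_segment_subset by blast
      then show ?thesis
        using log_convex_on_le_max[OF v(2) that] that by (simp add: u_def)
    qed
    moreover have "(\<integral>\<^sup>+x\<in>frontier P. u x \<partial>sg) = (\<integral>\<^sup>+x\<in>frontier P. v x \<partial>sg)"
      using polytope(6) by (intro nn_integral_cong) (auto simp: u_def indicator_def)
    ultimately have "(\<integral>\<^sup>+x\<in>interior P. epow (u x) crit \<partial>lborel) \<le> ennreal (C * B powr crit)"
      using C(2) B by simp
    then have "ennreal c * (\<integral>\<^sup>+x\<in>interior P. epow (u x) crit \<partial>lborel) \<le> ennreal c * ennreal (C * B powr crit)"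
      by (intro mult_left_mono) auto
    moreover have "(\<integral>\<^sup>+x. epow (v x) crit \<partial>intP) = (\<integral>\<^sup>+x. epow (u x) crit \<partial>intP)"
      using interior_subset[of P] by (intro nn_integral_cong) (auto simp: u_def)
    moreover have "\<dots> = ennreal c * (\<integral>\<^sup>+x\<in>interior P. epow (u x) crit \<partial>lborel)"
      using polytope(5) by (intro nn_integral_lborel_P(2)) (simp_all add: mult_ac)
    ultimately show "(\<integral>\<^sup>+x. epow (v x) crit \<partial>intP) \<le> ennreal (c * C * B powr crit)"
      using c C(1) by (simp add: ennreal_mult mult.assoc)
  qed (use c C(1) in simp)
qed

text \<open>All members have the same mass, and the reflection estimate turns mass into a pointwise
  bound with one constant for the whole class.\<close>

lemma Mp1_locally_bounded:
  assumes "x \<in> interior P"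
  shows "\<exists>d>0. \<exists>K\<ge>0. ball x d \<subseteq> interior P \<and> (\<forall>v\<in>Mp 1 P mu. \<forall>y\<in>ball x d. v y \<le> ennreal K)"
proof -
  obtain e where e: "e > 0" "ball x e \<subseteq> interior P"
    using assms open_contains_ball open_interior by blast
  \<comment> \<open>Half the radius, so that balls of radius \<open>d\<close> about points of
    \<open>ball x d\<close> stay inside \<open>P\<close>.\<close>
  define d where "d = e / 2"
  define \<beta> where "\<beta> = measure lborel (ball (0 :: real^'n) d)"
  have d: "d > 0"
    using e by (simp add: d_def)
  then have \<beta>: "\<beta> > 0" "emeasure lborel (ball (0 :: real^'n) d) = ennreal \<beta>"
    using emeasure_bounded_finite[OF bounded_ball, of "0 :: real^'n" d]
    by (auto simp: \<beta>_def content_ball_pos emeasure_eq_ennreal_measure)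
  show ?thesis
  \<comment> \<open>\<open>vol / c\<close> is the mass in Lebesgue measure, \<beta> the volume of
    the ball, and 2 comes from the two opposite points.\<close>
  proof (rule exI[of _ d], rule conjI[OF d], rule exI[of _ "2 * (vol / c) / \<beta>"], intro conjI ballI)
    show "ball x d \<subseteq> interior P"
      using e d by (auto simp: d_def)
    fix v y
    assume v: "v \<in> Mp 1 P mu" and y: "y \<in> ball x d"
    have m: "(\<lambda>x. v x * indicator P x) \<in> borel_measurable borel"
      using v by (intro lsc_measurable) (simp add: Mp1_iff)
    have sub: "ball y d \<subseteq> P"
    proof
      fix z assume "z \<in> ball y d"
      with y have "dist x z < e"
        using dist_triangle[of x z y] by (simp add: d_def)
      with e interior_subset[of P] show "z \<in> P" by auto
    qed
    then have yP: "y \<in> P"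
      using d by (meson centre_in_ball subsetD)
    have "v y * indicator P y * emeasure lborel (ball (0 :: real^'n) d) \<le> 2 * (\<integral>\<^sup>+x\<in>P. v x \<partial>lborel)"
    proof (rule quasiconvex_interior_bound[OF m, of y d])
      fix z z' assume z: "z \<in> ball y d" "z' \<in> ball y d" "y \<in> closed_segment z z'"
      then have "v y \<le> max (v z) (v z')"
        using sub v by (intro log_convex_on_le_max[of P]) (auto simp: Mp1_iff)
      then show "v y * indicator P y \<le> max (v z * indicator P z) (v z' * indicator P z')"
        using z sub yP by (simp add: subset_iff)
    qed
    also have "(\<integral>\<^sup>+x\<in>P. v x \<partial>lborel) = ennreal (vol / c)"
    proof -
      have "ennreal c * (\<integral>\<^sup>+x\<in>P. v x \<partial>lborel) = ennreal vol"
        using nn_integral_lborel_P(1)[OF m] v by (simp add: Mp1_iff)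
      also have "ennreal vol = ennreal c * ennreal (vol / c)"
        using c vol_facts(1) by (simp flip: ennreal_mult)
      finally show ?thesis
        using c by (simp add: ennreal_mult_cancel_left)
    qed
    finally have "v y * ennreal \<beta> \<le> ennreal (2 * (vol / c))"
      using \<beta> c vol_facts(1) yP ennreal_mult[of 2 "vol / c"] by simp
    then have "v y * ennreal \<beta> / ennreal \<beta> \<le> ennreal (2 * (vol / c)) / ennreal \<beta>"
      by (rule divide_right_mono_ennreal)
    then show "v y \<le> ennreal (2 * (vol / c) / \<beta>)"
      using \<beta> c vol_facts(1) by (simp add: mult_divide_eq_ennreal divide_ennreal)
  qed (use \<beta> c vol_facts(1) in simp)
qed

lemma Mp1_interior:
  assumes v: "v \<in> Mp 1 P mu" and x: "x \<in> interior P"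
  shows "v x = ennreal (enn2real (v x))" "0 < enn2real (v x)"
proof -
  obtain K where "v x \<le> ennreal K"
    using Mp1_locally_bounded[OF x] v by (meson centre_in_ball)
  then have fin: "v x < top"
    using ennreal_less_top order_le_less_trans by blast
  then show "v x = ennreal (enn2real (v x))"
    by simp
  have "0 < v x"
    using v x interior_subset[of P] by (auto simp: Mp1_iff)
  with fin show "0 < enn2real (v x)"
    by (simp add: enn2real_positive_iff)
qed

text \<open>The endpoint \<open>y\<close> may lie on the frontier, where \<open>v y\<close> can be
  infinite; the finite bound \<open>s\<close> takes its place so that the inequality can be stated
  in reals.\<close>

lemma Mp1_log_convex:
  assumes v: "v \<in> Mp 1 P mu" and x: "x \<in> interior P" and y: "y \<in> P" "v y \<le> ennreal s" and s: "0 < s"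
    and t: "0 \<le> t" "t \<le> 1"
  shows "enn2real (v ((1 - t) *\<^sub>R x + t *\<^sub>R y)) \<le> enn2real (v x) powr (1 - t) * s powr t"
proof -
  have pow: "epow (ennreal a) q = ennreal (a powr q)" if "a > 0" for a q
    using that by (simp add: epow_def)
  have "v ((1 - t) *\<^sub>R x + t *\<^sub>R y) \<le> epow (v x) (1 - t) * epow (v y) t"
    using v x y t interior_subset[of P] by (auto simp: Mp1_iff log_convex_on_def)
  also have "\<dots> \<le> epow (ennreal (enn2real (v x))) (1 - t) * epow (ennreal s) t"
    using y t Mp1_interior(1)[OF v x] by (intro mult_mono epow_mono) auto
  also have "\<dots> = ennreal (enn2real (v x) powr (1 - t) * s powr t)"
    using Mp1_interior(2)[OF v x] s by (simp add: pow ennreal_mult)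
  finally show ?thesis
    by (intro enn2real_leI) auto
qed

text \<open>The weighted mean inequality turns log-convexity into convexity, as the compactness
  theorem requires.\<close>

lemma Mp1_convex_on:
  assumes v: "v \<in> Mp 1 P mu"
  shows "convex_on (interior P) (\<lambda>x. enn2real (v x))"
proof (rule convex_onI)
  fix t x y assume t: "0 < (t::real)" "t < 1" and x: "x \<in> interior P" and y: "y \<in> interior P"
  have "enn2real (v ((1 - t) *\<^sub>R x + t *\<^sub>R y)) \<le> enn2real (v x) powr (1 - t) * enn2real (v y) powr t"
    using Mp1_interior[OF v y] t y interior_subset[of P] by (intro Mp1_log_convex[OF v x]) auto
  also have "\<dots> \<le> (1 - t) * enn2real (v x) + t * enn2real (v y)"
    using t Mp1_interior(2)[OF v x] Mp1_interior(2)[OF v y] by (intro Youngs_inequality_0) auto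
  finally show "enn2real (v ((1 - t) *\<^sub>R x + t *\<^sub>R y)) \<le> (1 - t) * enn2real (v x) + t * enn2real (v y)" .
qed (use polytope(4) in simp)

lemma Mp1_measurable:
  assumes v: "v \<in> Mp 1 P mu"
  shows "(\<lambda>x. enn2real (v x)) \<in> borel_measurable intP"
  using Mp1_convex_on[OF v]
  by (intro measurable_intP borel_measurable_continuous_on_restrict convex_on_continuous) auto

lemma Mp1_integral:
  assumes v: "v \<in> Mp 1 P mu"
  shows "(\<integral>x. enn2real (v x) \<partial>intP) = vol"
proof -
  have "(\<integral>\<^sup>+x. ennreal (enn2real (v x)) \<partial>intP) = (\<integral>\<^sup>+x. v x \<partial>intP)"
    using Mp1_interior(1)[OF v] by (intro nn_integral_cong) simp
  also have "\<dots> = ennreal vol"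
    using v by (simp add: Mp1_iff)
  finally show ?thesis
    using vol_facts(1) Mp1_measurable[OF v] by (simp add: integral_eq_nn_integral)
qed

lemma Mp1_power_integral:
  assumes "v \<in> Mp 1 P mu"
  shows "(\<integral>\<^sup>+x. ennreal (enn2real (v x) powr crit) \<partial>intP) = (\<integral>\<^sup>+x. epow (v x) crit \<partial>intP)"
proof (rule nn_integral_cong)
  fix x assume "x \<in> space intP"
  then show "ennreal (enn2real (v x) powr crit) = epow (v x) crit"
    using Mp1_interior[OF assms, of x] crit_gt_1 by (metis epow_ennreal enn2real_nonneg less_trans space_intP zero_less_one)
qed

section \<open>The free energy of normalized functions\<close>

lemma int_ulogu_eq:
  assumes v: "v \<in> Mp 1 P mu"
  shows "int_ulogu P mu v = enn2ereal (\<integral>\<^sup>+x. ennreal (x_ln_x (enn2real (v x))) \<partial>intP)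
    - enn2ereal (\<integral>\<^sup>+x. ennreal (- x_ln_x (enn2real (v x))) \<partial>intP)"
proof -
  have *: "xlogx (v x) = ereal (x_ln_x (enn2real (v x)))" if "x \<in> interior P" for x
    using Mp1_interior(1)[OF v that] unfolding xlogx_def x_ln_x_def by (metis ennreal_neq_top infinity_ennreal_def)
  \<comment> \<open>\<open>ennreal\<close> sends negative reals to 0, so the positive part is
    implicit.\<close>
  have e: "e2ennreal (max 0 (ereal y)) = ennreal y" for y
    by (simp add: max_def zero_ereal_def ennreal_neg del: ereal_eq_0)
  have "(\<integral>\<^sup>+x. e2ennreal (max 0 (xlogx (v x))) \<partial>intP) = (\<integral>\<^sup>+x. ennreal (x_ln_x (enn2real (v x))) \<partial>intP)"
    by (intro nn_integral_cong) (simp only: * e space_intP)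
  moreover have "(\<integral>\<^sup>+x. e2ennreal (max 0 (- xlogx (v x))) \<partial>intP) = (\<integral>\<^sup>+x. ennreal (- x_ln_x (enn2real (v x))) \<partial>intP)"
    by (intro nn_integral_cong) (simp only: * e space_intP uminus_ereal.simps)
  ultimately show ?thesis
    unfolding int_ulogu_def nn_integral_P by simp
qed

text \<open>\<open>T\<close> enters with a plus sign because the entropy is
  \<open>- (ulogu v / vol)\<close>.\<close>

lemma free_energy_eq:
  assumes v: "v \<in> Mp 1 P mu" and B: "(\<integral>\<^sup>+x\<in>frontier P. v x \<partial>sg) = ennreal B" "0 \<le> B"
    and int: "integrable intP (\<lambda>x. x_ln_x (enn2real (v x)))"
  shows "free_energy P mu sg T v = ereal ((B + T * ulogu v) / vol)"
proof -
  obtain r q where rq: "0 \<le> r" "0 \<le> q"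
    "(\<integral>\<^sup>+x. ennreal (x_ln_x (enn2real (v x))) \<partial>intP) = ennreal r"
    "(\<integral>\<^sup>+x. ennreal (- x_ln_x (enn2real (v x))) \<partial>intP) = ennreal q"
    "(\<integral>x. x_ln_x (enn2real (v x)) \<partial>intP) = r - q"
    using integrableE[OF int] by metis
  have ent: "entropy P mu v = ereal (- (ulogu v / vol))"
    using vol_facts(1) rq by (simp add: entropy_def int_ulogu_eq[OF v] vol_facts(2) ulogu_def)
  have "internal_energy P mu sg v = ennreal (B / vol)"
    unfolding internal_energy_def B(1) vol_facts(2) using vol_facts(1) B(2) by (simp flip: ennreal_mult)
  then show ?thesis
    using vol_facts(1) B(2) by (simp add: free_energy_def ent add_divide_distrib)
qed

text \<open>As \<open>x_ln_x\<close> is at least -1, the negative part has finite integral, so the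
  entropy is a real number or minus infinity. The free energy is infinite in either case, for any
  sign of \<open>T\<close>.\<close>

lemma free_energy_infinite:
  assumes v: "v \<in> Mp 1 P mu" and B: "(\<integral>\<^sup>+x\<in>frontier P. v x \<partial>sg) = \<infinity>"
  shows "free_energy P mu sg T v = \<infinity>"
proof -
  have "(\<integral>\<^sup>+x. ennreal (- x_ln_x (enn2real (v x))) \<partial>intP) \<le> (\<integral>\<^sup>+x. 1 \<partial>intP)"
  proof (rule nn_integral_mono)
    fix x
    show "ennreal (- x_ln_x (enn2real (v x))) \<le> 1"
      using x_ln_x_ge[of "enn2real (v x)"] ennreal_leI[of "- x_ln_x (enn2real (v x))" 1] by simp
  qed
  also have "\<dots> < \<infinity>"
    using finite_intP by (simp add: finite_measure.emeasure_finite less_top[symmetric])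
  finally obtain q where q: "(\<integral>\<^sup>+x. ennreal (- x_ln_x (enn2real (v x))) \<partial>intP) = ennreal q" "0 \<le> q"
    by (cases "\<integral>\<^sup>+x. ennreal (- x_ln_x (enn2real (v x))) \<partial>intP") auto
  have U: "internal_energy P mu sg v = \<infinity>"
    unfolding internal_energy_def B vol_facts(2) using vol_facts(1) by (simp add: ennreal_mult_top)
  show ?thesis
  proof (cases "\<integral>\<^sup>+x. ennreal (x_ln_x (enn2real (v x))) \<partial>intP")
    case (real r)
    then have "entropy P mu v = ereal (- ((r - q) / vol))"
      using vol_facts(1) q by (simp add: entropy_def int_ulogu_eq[OF v] vol_facts(2))
    then show ?thesis
      by (simp add: free_energy_def U)
  next
    case top
    then have "entropy P mu v = - \<infinity>"
      using vol_facts(1) q by (simp add: entropy_def int_ulogu_eq[OF v] vol_facts(2))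
    then show ?thesis
      by (simp add: free_energy_def)
  qed
qed

lemma Mp1_facts:
  assumes v: "v \<in> Mp 1 P mu" and B: "(\<integral>\<^sup>+x\<in>frontier P. v x \<partial>sg) \<le> ennreal B" "0 \<le> B"
  shows "integrable intP (\<lambda>x. enn2real (v x) powr crit)" "integrable intP (\<lambda>x. x_ln_x (enn2real (v x)))"
    "integrable intP (\<lambda>x. enn2real (v x))"
proof -
  interpret finite_measure intP by (rule finite_intP)
  obtain C where C: "(\<integral>\<^sup>+x. ennreal (enn2real (v x) powr crit) \<partial>intP) \<le> ennreal C"
    using power_integral_bound v B unfolding Mp1_power_integral[OF v] Mp1_iff by meson
  note [measurable] = Mp1_measurable[OF v]
  show "integrable intP (\<lambda>x. enn2real (v x) powr crit)"
    using C by (intro integrableI_nonneg) (auto intro: le_less_trans)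
  show "integrable intP (\<lambda>x. x_ln_x (enn2real (v x)))"
    \<comment> \<open>Applied to a constant sequence, the convergence theorem yields plain
      integrability.\<close>
    using crit_gt_1 by (intro integral_convergence_of_bounded_power(2)[of "\<lambda>_ x. enn2real (v x)" "\<lambda>x. enn2real (v x)" crit C, OF _ _ _ _ _ C])
      (auto intro: continuous_on_x_ln_x x_ln_x_little_o)
  show "integrable intP (\<lambda>x. enn2real (v x))"
    using crit_gt_1 by (intro integral_convergence_of_bounded_power(2)[of "\<lambda>_ x. enn2real (v x)" "\<lambda>x. enn2real (v x)" crit C, OF _ _ _ _ _ C])
      (auto intro: id_little_o)
qed

text \<open>The tangent line of the logarithm at \<open>A = 1 + C * B powr crit\<close>, which dominates the critical power
  integral, bounds the entropy by a multiple of \<open>ln A\<close>; this grows slower than the energy \<open>B\<close>.\<close>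

lemma coercive:
  "\<exists>K. \<forall>v\<in>Mp 1 P mu. \<forall>B\<ge>0. (\<integral>\<^sup>+x\<in>frontier P. v x \<partial>sg) = ennreal B \<longrightarrow> B / 2 - K \<le> B + T * ulogu v"
proof -
  interpret finite_measure intP by (rule finite_intP)
  obtain C where C: "C \<ge> 0" "\<And>v B. lsc_on P v \<Longrightarrow> log_convex_on P v \<Longrightarrow> 0 \<le> B \<Longrightarrow> (\<integral>\<^sup>+x\<in>frontier P. v x \<partial>sg) \<le> ennreal B \<Longrightarrow>
      (\<integral>\<^sup>+x. epow (v x) crit \<partial>intP) \<le> ennreal (C * B powr crit)"
    using power_integral_bound by auto
  define D where "D = \<bar>T\<bar> * (vol / (crit - 1))"
  \<comment> \<open>With slope 1 / 2 the logarithmic term costs at most half of the energy.\<close>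
  obtain K where K: "\<And>b. 0 \<le> b \<Longrightarrow> D * ln (1 + C * b powr crit) \<le> (1 / 2) * b + K"
    using ln_powr_bound[OF C(1), of crit "1 / 2" D] crit_gt_1 by (metis half_gt_zero_iff less_trans zero_less_one)
  show ?thesis
  proof (intro exI[of _ "K + \<bar>T\<bar> * (vol + 1 / (crit - 1))"] ballI allI impI)
    fix v and B :: real
    assume v: "v \<in> Mp 1 P mu" and B: "0 \<le> B" "(\<integral>\<^sup>+x\<in>frontier P. v x \<partial>sg) = ennreal B"
    note int = Mp1_facts[OF v eq_refl[OF B(2)] B(1)]
    define A where "A = 1 + C * B powr crit"
    have A: "A \<ge> 1" "A > 0"
      using C(1) by (simp_all add: A_def add_pos_nonneg)
    have pow: "(\<integral>x. enn2real (v x) powr crit \<partial>intP) \<le> C * B powr crit"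
    proof -
      have "ennreal (\<integral>x. enn2real (v x) powr crit \<partial>intP) \<le> ennreal (C * B powr crit)"
        using C(2)[of v B] v B Mp1_power_integral[OF v] int(1)
        by (simp add: Mp1_iff nn_integral_eq_integral)
      then show ?thesis
        using C(1) by (simp add: ennreal_le_iff)
    qed
    have "ulogu v \<le> (\<integral>x. (enn2real (v x) powr crit / A + enn2real (v x) * ln A) / (crit - 1) \<partial>intP)"
      unfolding ulogu_def using int crit_gt_1 A
      by (intro integral_mono x_ln_x_le) auto
    also have "\<dots> = ((\<integral>x. enn2real (v x) powr crit \<partial>intP) / A + vol * ln A) / (crit - 1)"
      using int Mp1_integral[OF v] by simp
    also have "\<dots> \<le> (1 + vol * ln A) / (crit - 1)"
    proof -
      have "(\<integral>x. enn2real (v x) powr crit \<partial>intP) / A \<le> 1"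
        using pow A by (simp add: A_def)
      then show ?thesis
        using crit_gt_1 by (intro divide_right_mono) auto
    qed
    finally have upper: "ulogu v \<le> (1 + vol * ln A) / (crit - 1)" .
    have "- vol = (\<integral>x. - 1 \<partial>intP)"
      by (simp add: vol_def)
    also have "\<dots> \<le> ulogu v"
      unfolding ulogu_def using int by (intro integral_mono x_ln_x_ge) auto
    finally have lower: "- vol \<le> ulogu v" .
    have lnA: "0 \<le> vol * ln A / (crit - 1)"
      using A vol_facts(1) crit_gt_1 by simp
    have "0 \<le> 1 / (crit - 1)"
      using crit_gt_1 by simp
    \<comment> \<open>A negative \<open>T\<close> calls for the upper bound and a positive
      \<open>T\<close> for the lower one; the absolute value treats both.\<close>
    with upper lower lnA vol_facts(1) have "\<bar>ulogu v\<bar> \<le> vol + 1 / (crit - 1) + vol * ln A / (crit - 1)"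
      unfolding add_divide_distrib by linarith
    then have "\<bar>T\<bar> * \<bar>ulogu v\<bar> \<le> \<bar>T\<bar> * (vol + 1 / (crit - 1) + vol * ln A / (crit - 1))"
      by (intro mult_left_mono) auto
    also have "\<dots> = \<bar>T\<bar> * (vol + 1 / (crit - 1)) + D * ln A"
      by (simp add: D_def distrib_left)
    also have "\<dots> \<le> \<bar>T\<bar> * (vol + 1 / (crit - 1)) + (1 / 2 * B + K)"
      using K[OF B(1)] by (simp add: A_def)
    finally show "B / 2 - (K + \<bar>T\<bar> * (vol + 1 / (crit - 1))) \<le> B + T * ulogu v"
      unfolding abs_mult[symmetric] by linarith
  qed
qed

section \<open>A competitor of finite energy\<close>

lemma emeasure_frontier_finite: "emeasure sg (frontier P) < \<infinity>"
proof -
  have fr: "frontier P = \<Union>{F. F facet_of P}"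
    using polytope(1,3) rel_frontier_of_polyhedron[of P] rel_frontier_nonempty_interior[of P] by simp
  have fin: "finite {F. F facet_of P}"
    using polytope(1) by (rule finite_polyhedron_facets)
  have facet: "F \<in> sets sg" "emeasure sg F < \<infinity>" if F: "F facet_of P" for F
  proof -
    have "closed F"
      using F polytope(1) by (meson face_of_imp_closed facet_of_imp_face_of polyhedron_imp_closed polyhedron_imp_convex)
    then show Fs: "F \<in> sets sg"
      by (simp add: boundary_sg(2))
    obtain a p and L :: "real^'m \<Rightarrow> real^'n" where L: "linear L" "inj L"
      and eq: "\<forall>A\<in>sets borel. emeasure sg (A \<inter> F) = ennreal a * emeasure lborel {y. p + L y \<in> A \<inter> F}"
      using boundary_sg(1) F unfolding boundary_measure_def by metis
    \<comment> \<open>An injective linear map is bounded below, so a bounded facet has a bounded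
      parameter set, of finite Lebesgue measure.\<close>
    obtain b where b: "b > 0" "\<And>y. b * norm y \<le> norm (L y)"
      by (rule linear_inj_bounded_below_pos[OF L]) (rule that)
    have "bounded F"
      using bounded_subset[OF compact_imp_bounded[OF polytope(2)] facet_of_imp_subset[OF F]] .
    then obtain R where "\<forall>x\<in>F. norm x \<le> R"
      unfolding bounded_iff by (rule exE)
    then have R: "\<And>x. x \<in> F \<Longrightarrow> norm x \<le> R"
      by (rule bspec)
    have "norm y \<le> (R + norm p) / b" if "p + L y \<in> F" for y
    proof -
      have "b * norm y \<le> norm ((p + L y) - p)"
        using b(2)[of y] by simp
      also have "\<dots> \<le> R + norm p"
        using R[OF that] norm_triangle_ineq4[of "p + L y" p] by linarith
      finally show ?thesis
        using b(1) by (simp add: field_simps)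
    qed
    then have "bounded {y. p + L y \<in> F}"
      unfolding bounded_iff by blast
    then have "emeasure lborel {y. p + L y \<in> F} < \<infinity>"
      by (rule emeasure_bounded_finite)
    then show "emeasure sg F < \<infinity>"
      using eq[rule_format, of UNIV] by (simp add: ennreal_mult_less_top)
  qed
  have "emeasure sg (frontier P) \<le> (\<Sum>F\<in>{F. F facet_of P}. emeasure sg F)"
    unfolding fr using emeasure_subadditive_finite[OF fin, of id sg] facet by auto
  also have "\<dots> < \<infinity>"
    using fin facet by simp
  finally show ?thesis .
qed

text \<open>The constant 1 makes the set of competitors with finite energy nonempty.\<close>

lemma one_Mp1: "(\<lambda>_. 1) \<in> Mp 1 P mu" "(\<integral>\<^sup>+x\<in>frontier P. 1 \<partial>sg) < \<infinity>"
proof -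
  have "lsc_on P (\<lambda>_. 1)"
    unfolding lsc_on_def
  proof
    fix x assume "x \<in> P"
    show "1 \<le> Liminf (at x within P) (\<lambda>_. 1 :: ennreal)"
      by (rule Liminf_bounded) simp
  qed
  then show "(\<lambda>_. 1) \<in> Mp 1 P mu"
    using emeasure_P vol_facts(2) by (simp add: Mp1_iff log_convex_on_def)
  have "frontier P \<in> sets sg"
    by (simp add: boundary_sg(2))
  then show "(\<integral>\<^sup>+x\<in>frontier P. 1 \<partial>sg) < \<infinity>"
    using emeasure_frontier_finite by simp
qed

section \<open>Compactness at bounded energy and the direct method\<close>

theorem Mp1_compactness:
  assumes v: "\<And>i. v i \<in> Mp 1 P mu" and B: "0 \<le> B" "\<And>i. (\<integral>\<^sup>+x\<in>frontier P. v i x \<partial>sg) \<le> ennreal B"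
  obtains k u where "strict_mono (k :: nat \<Rightarrow> nat)" "u \<in> Mp 1 P mu" "u \<in> Mp crit P mu"
    "(\<lambda>i. ulogu (v (k i))) \<longlonglongrightarrow> ulogu u"
    "(\<integral>\<^sup>+x\<in>frontier P. u x \<partial>sg) \<le> liminf (\<lambda>i. \<integral>\<^sup>+x\<in>frontier P. v (k i) x \<partial>sg)"
proof -
  interpret finite_measure intP by (rule finite_intP)
  define r where "r i x = enn2real (v i x)" for i x
  obtain k :: "nat \<Rightarrow> nat" where k: "strict_mono k" "\<And>x. x \<in> interior P \<Longrightarrow> convergent (\<lambda>i. r (k i) x)"
  proof (rule convex_functions_convergent_subsequence[of "interior P" r])
    show "convex_on (interior P) (r i)" for i
      unfolding r_def by (rule Mp1_convex_on[OF v])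
    show "\<exists>d>0. \<exists>M. ball x d \<subseteq> interior P \<and> (\<forall>i. \<forall>y\<in>ball x d. r i y \<le> M)" if x: "x \<in> interior P" for x
    proof -
      obtain d K where d: "d > 0" "K \<ge> 0" "ball x d \<subseteq> interior P"
        and K: "\<forall>v\<in>Mp 1 P mu. \<forall>y\<in>ball x d. v y \<le> ennreal K"
        using Mp1_locally_bounded[OF x] by (elim exE conjE) (rule that)
      have "\<forall>i. \<forall>y\<in>ball x d. r i y \<le> K"
        unfolding r_def using K v d(2) by (intro allI ballI enn2real_leI) auto
      with d show ?thesis by blast
    qed
  qed (auto simp: r_def)
  define f where "f i = r (k i)" for i
  define w where "w x = lim (\<lambda>i. f i x)" for x
  have lim: "(\<lambda>i. f i x) \<longlonglongrightarrow> w x" if "x \<in> interior P" for x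
    using k(2)[OF that] unfolding w_def f_def by (simp add: convergent_LIMSEQ_iff)
  have f_pos: "0 < f i x" if "x \<in> interior P" for i x
    unfolding f_def r_def by (rule Mp1_interior(2)[OF v that])
  have w0: "0 \<le> w x" if "x \<in> interior P" for x
    using less_imp_le[OF f_pos[OF that]] by (intro LIMSEQ_le_const[OF lim[OF that]]) auto
  have fm [measurable]: "f i \<in> borel_measurable intP" for i
    unfolding f_def r_def by (rule Mp1_measurable[OF v])
  have wm [measurable]: "w \<in> borel_measurable intP"
    by (rule borel_measurable_LIMSEQ_real[OF lim fm]) simp
  obtain C where C: "\<And>i. (\<integral>\<^sup>+x. ennreal (f i x powr crit) \<partial>intP) \<le> ennreal C"
  proof -
    obtain C where "\<forall>v b. lsc_on P v \<longrightarrow> log_convex_on P v \<longrightarrow> 0 \<le> b \<longrightarrow> (\<integral>\<^sup>+x\<in>frontier P. v x \<partial>sg) \<le> ennreal b \<longrightarrow>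
      (\<integral>\<^sup>+x. epow (v x) crit \<partial>intP) \<le> ennreal (C * b powr crit)"
      using power_integral_bound by (elim exE conjE) (rule that)
    then have "(\<integral>\<^sup>+x. ennreal (f i x powr crit) \<partial>intP) \<le> ennreal (C * B powr crit)" for i
      using v[of "k i"] B unfolding f_def r_def Mp1_power_integral[OF v] by (simp add: Mp1_iff)
    then show ?thesis by (rule that)
  qed
  have nonneg: "\<And>i x. x \<in> space intP \<Longrightarrow> 0 \<le> f i x" "\<And>x. x \<in> space intP \<Longrightarrow> 0 \<le> w x"
    and lim': "\<And>x. x \<in> space intP \<Longrightarrow> (\<lambda>i. f i x) \<longlonglongrightarrow> w x"
    using f_pos w0 lim by (auto intro: less_imp_le)
  have crit0: "crit > 0"
    using crit_gt_1 by simp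
  have conv: "(\<integral>\<^sup>+x. ennreal (w x powr crit) \<partial>intP) \<le> ennreal C" "integrable intP (\<lambda>x. g (w x))"
    "(\<lambda>i. \<integral>x. g (f i x) \<partial>intP) \<longlonglongrightarrow> (\<integral>x. g (w x) \<partial>intP)"
    if g: "continuous_on {0..} g" "((\<lambda>x. g x / x powr crit) \<longlongrightarrow> 0) at_top" for g
    using integral_convergence_of_bounded_power(1,3,4)[of f w crit C g] fm wm nonneg lim' C crit0 g by blast+
  note wC = conv(1)[OF continuous_on_x_ln_x x_ln_x_little_o[OF crit_gt_1]]
  note ent = conv(3)[OF continuous_on_x_ln_x x_ln_x_little_o[OF crit_gt_1]]
  \<comment> \<open>With the identity for \<open>g\<close>, the convergence theorem shows that no
    mass is lost in the limit.\<close>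
  have w_int: "integrable intP w" and "(\<lambda>i. \<integral>x. f i x \<partial>intP) \<longlonglongrightarrow> (\<integral>x. w x \<partial>intP)"
    using conv(2,3)[OF continuous_on_id id_little_o[OF crit_gt_1]] by simp_all
  then have "(\<lambda>i. vol) \<longlonglongrightarrow> (\<integral>x. w x \<partial>intP)"
    unfolding f_def r_def Mp1_integral[OF v] by simp
  then have w_vol: "(\<integral>x. w x \<partial>intP) = vol"
    using LIMSEQ_unique tendsto_const by blast
  have w_lc: "w ((1 - t) *\<^sub>R x + t *\<^sub>R y) \<le> w x powr (1 - t) * w y powr t"
    if x: "x \<in> interior P" and y: "y \<in> interior P" and t: "0 < t" "t < 1" for x y t
  proof (rule LIMSEQ_le)
    have "(1 - t) *\<^sub>R x + t *\<^sub>R y \<in> interior P"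
      using x y t polytope(4) by (intro convexD_alt[of "interior P"]) auto
    then show "(\<lambda>i. f i ((1 - t) *\<^sub>R x + t *\<^sub>R y)) \<longlonglongrightarrow> w ((1 - t) *\<^sub>R x + t *\<^sub>R y)"
      by (rule lim)
    show "(\<lambda>i. f i x powr (1 - t) * f i y powr t) \<longlonglongrightarrow> w x powr (1 - t) * w y powr t"
      using t f_pos[OF x] f_pos[OF y]
      by (intro tendsto_mult tendsto_powr' lim x y tendsto_const) (auto intro!: always_eventually less_imp_le)
    have "f i ((1 - t) *\<^sub>R x + t *\<^sub>R y) \<le> f i x powr (1 - t) * f i y powr t" for i
      unfolding f_def r_def
      using Mp1_interior[OF v y] t y interior_subset[of P] by (intro Mp1_log_convex[OF v x]) auto
    then show "\<exists>N. \<forall>i\<ge>N. f i ((1 - t) *\<^sub>R x + t *\<^sub>R y) \<le> f i x powr (1 - t) * f i y powr t"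
      by blast
  qed
  \<comment> \<open>A zero at one interior point would spread over the whole interior by
    log-convexity and contradict the positive mass \<open>vol\<close>.\<close>
  have w_pos: "0 < w x" if x: "x \<in> interior P" for x
  proof (rule ccontr)
    assume "\<not> 0 < w x"
    with w0[OF x] have wx: "w x = 0" by simp
    have "w y = 0" if y: "y \<in> interior P" for y
    proof -
      \<comment> \<open>A factor slightly above 1 extends the segment from \<open>x\<close> beyond
        \<open>y\<close> within the open interior, so that \<open>y\<close> lies strictly between
        \<open>x\<close> and the new point.\<close>
      obtain e where e: "e > 1" "(1 - e) *\<^sub>R x + e *\<^sub>R y \<in> interior P"
      proof -
        have "((\<lambda>e. (1 - e) *\<^sub>R x + e *\<^sub>R y) \<longlongrightarrow> (1 - 1) *\<^sub>R x + 1 *\<^sub>R y) (at_right 1)"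
          by (intro tendsto_intros)
        then have "eventually (\<lambda>e. (1 - e) *\<^sub>R x + e *\<^sub>R y \<in> interior P) (at_right 1)"
          using y by (intro topological_tendstoD) auto
        then have "eventually (\<lambda>e. e > 1 \<and> (1 - e) *\<^sub>R x + e *\<^sub>R y \<in> interior P) (at_right (1 :: real))"
          by (intro eventually_conj eventually_at_right_less) auto
        then show ?thesis
          using that eventually_happens trivial_limit_at_right_real by blast
      qed
      define z where "z = (1 - e) *\<^sub>R x + e *\<^sub>R y"
      have "(1 - 1 / e) *\<^sub>R x + (1 / e) *\<^sub>R z = y"
        using e(1) by (simp add: z_def algebra_simps flip: scaleR_left_distrib)
      then have "w y \<le> w x powr (1 - 1 / e) * w z powr (1 / e)"
        using w_lc[OF x e(2), of "1 / e"] e(1) by (simp add: z_def)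
      then show "w y = 0"
        using wx w0[OF y] by simp
    qed
    then have "(\<integral>x. w x \<partial>intP) = (\<integral>x. 0 \<partial>intP)"
      by (intro Bochner_Integration.integral_cong) auto
    with w_vol vol_facts(1) show False by simp
  qed
  define \<phi> where "\<phi> x = ln (w x)" for x
  have exp\<phi>: "exp (\<phi> x) = w x" if "x \<in> interior P" for x
    using w_pos[OF that] by (simp add: \<phi>_def)
  have \<phi>: "convex_on (interior P) \<phi>"
  proof (rule convex_onI)
    fix t x y assume t: "0 < (t::real)" "t < 1" and x: "x \<in> interior P" and y: "y \<in> interior P"
    have z: "(1 - t) *\<^sub>R x + t *\<^sub>R y \<in> interior P"
      using x y t polytope(4) by (intro convexD_alt[of "interior P"]) auto
    have "\<phi> ((1 - t) *\<^sub>R x + t *\<^sub>R y) \<le> ln (w x powr (1 - t) * w y powr t)"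
      unfolding \<phi>_def using w_lc[OF x y t] w_pos[OF z] w_pos[OF x] w_pos[OF y] by (subst ln_le_cancel_iff) auto
    also have "\<dots> = (1 - t) * \<phi> x + t * \<phi> y"
      using w_pos[OF x] w_pos[OF y] by (simp add: \<phi>_def ln_mult ln_powr)
    finally show "\<phi> ((1 - t) *\<^sub>R x + t *\<^sub>R y) \<le> (1 - t) * \<phi> x + t * \<phi> y" .
  qed (use polytope(4) in simp)
  obtain x0 where x0: "x0 \<in> interior P"
    using polytope(3) by blast
  define u where "u = radial_extension \<phi> x0"
  have u_int: "u x = ennreal (w x)" if "x \<in> interior P" for x
    unfolding u_def using radial_extension_interior[OF polytope(4) x0 \<phi> that] exp\<phi>[OF that] by simp
  have u_lsc: "lsc_on P u" and u_lc: "log_convex_on P u" and u_pos: "0 < u x" for x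
    unfolding u_def using lsc_on_radial_extension[OF polytope(4) x0 \<phi>] log_convex_on_radial_extension[OF polytope(4) x0 \<phi>]
      radial_extension_pos[OF polytope(4) x0 \<phi>] by auto
  have u_nn: "(\<integral>\<^sup>+x. u x \<partial>intP) = ennreal vol"
  proof -
    have "(\<integral>\<^sup>+x. u x \<partial>intP) = (\<integral>\<^sup>+x. ennreal (w x) \<partial>intP)"
      by (intro nn_integral_cong) (simp add: u_int)
    also have "\<dots> = ennreal (\<integral>x. w x \<partial>intP)"
      using w_int nonneg(2) by (intro nn_integral_eq_integral) auto
    finally show ?thesis
      by (simp add: w_vol)
  qed
  have u1: "u \<in> Mp 1 P mu"
    using u_lsc u_lc u_pos u_nn by (simp add: Mp1_iff)
  have "(\<integral>\<^sup>+x. epow (u x) crit \<partial>intP) = (\<integral>\<^sup>+x. ennreal (w x powr crit) \<partial>intP)"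
    using w0 crit0 by (intro nn_integral_cong) (simp add: u_int epow_ennreal)
  then have "(\<integral>\<^sup>+x. epow (u x) crit \<partial>intP) < \<infinity>"
    using wC by (auto intro: le_less_trans)
  then have uc: "u \<in> Mp crit P mu"
    using u_lsc u_lc u_pos u_nn by (simp add: Mp_def nn_integral_P vol_facts)
  have "(\<integral>x. x_ln_x (w x) \<partial>intP) = ulogu u"
    unfolding ulogu_def using w0 by (intro Bochner_Integration.integral_cong) (auto simp: u_int)
  with ent have u_ent: "(\<lambda>i. ulogu (v (k i))) \<longlonglongrightarrow> ulogu u"
    by (simp add: ulogu_def f_def r_def)
  \<comment> \<open>If the lower limit at \<open>x\<close> is below a real \<open>s\<close>, then
    \<open>v (k i) x\<close> is below \<open>s\<close> for infinitely many \<open>i\<close>. For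
    these, log-convexity between \<open>x0\<close> and \<open>x\<close> bounds \<open>f i\<close> on
    the open segment; \<open>f i\<close> converges there, so \<open>w\<close> inherits the bound and
    \<open>radial_extension_le\<close> returns it to \<open>x\<close>.\<close>
  have u_le: "u x \<le> liminf (\<lambda>i. v (k i) x)" if x: "x \<in> P" for x
  proof (rule dense_ge)
    fix a assume a: "liminf (\<lambda>i. v (k i) x) < a"
    show "u x \<le> a"
    proof (cases a)
      case (real s)
      have s: "0 < s"
        using a real by (cases "s = 0") auto
      have fr: "\<not> eventually (\<lambda>i. a \<le> v (k i) x) sequentially"
        using a Liminf_bounded[of a "\<lambda>i. v (k i) x" sequentially] by (auto simp: not_le[symmetric])
      have "u x \<le> ennreal s"
        unfolding u_def
      proof (rule radial_extension_le[OF polytope(4) x0 \<phi> s])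
        fix t :: real assume t: "0 < t" "t < 1"
        define y where "y = (1 - t) *\<^sub>R x0 + t *\<^sub>R x"
        have y: "y \<in> interior P"
          unfolding y_def by (rule radial_point_interior[OF polytope(4) x0 \<phi> x t])
        have "w y \<le> w x0 powr (1 - t) * s powr t"
        \<comment> \<open>A strict failure in the limit would hold for all large \<open>i\<close>
          and force \<open>a \<le> v (k i) x\<close> eventually, against \<open>fr\<close>.\<close>
        proof (rule ccontr)
          assume "\<not> ?thesis"
          then have "0 < w y - w x0 powr (1 - t) * s powr t"
            by simp
          moreover have "(\<lambda>i. f i y - f i x0 powr (1 - t) * s powr t) \<longlonglongrightarrow> w y - w x0 powr (1 - t) * s powr t"
            using t f_pos[OF x0]
            by (intro tendsto_diff tendsto_mult tendsto_powr' lim x0 y tendsto_const) (auto intro!: always_eventually less_imp_le)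
          ultimately have "eventually (\<lambda>i. 0 < f i y - f i x0 powr (1 - t) * s powr t) sequentially"
            by (intro order_tendstoD(1))
          then have "eventually (\<lambda>i. a \<le> v (k i) x) sequentially"
          proof eventually_elim
            case (elim i)
            show ?case
            proof (rule ccontr)
              assume "\<not> a \<le> v (k i) x"
              then have "v (k i) x \<le> ennreal s"
                using real by simp
              from Mp1_log_convex[OF v x0 x this s, of t] t
              have "f i y \<le> f i x0 powr (1 - t) * s powr t"
                by (simp add: f_def r_def y_def)
              with elim show False by simp
            qed
          qed
          with fr show False by blast
        qed
        then show "exp (\<phi> ((1 - t) *\<^sub>R x0 + t *\<^sub>R x)) \<le> exp (\<phi> x0) powr (1 - t) * s powr t"
          using exp\<phi>[OF y] exp\<phi>[OF x0] by (simp add: y_def)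
      qed
      with real show ?thesis by simp
    qed simp
  qed
  have "(\<integral>\<^sup>+x\<in>frontier P. u x \<partial>sg) \<le> (\<integral>\<^sup>+x. liminf (\<lambda>i. v (k i) x * indicator (frontier P) x) \<partial>sg)"
  proof (rule nn_integral_mono)
    fix x
    show "u x * indicator (frontier P) x \<le> liminf (\<lambda>i. v (k i) x * indicator (frontier P) x)"
      using u_le[of x] polytope(6) by (auto simp: indicator_def)
  qed
  also have "\<dots> \<le> liminf (\<lambda>i. \<integral>\<^sup>+x\<in>frontier P. v (k i) x \<partial>sg)"
    using v by (intro nn_integral_liminf lsc_measurable_frontier) (simp add: Mp1_iff)
  finally have "(\<integral>\<^sup>+x\<in>frontier P. u x \<partial>sg) \<le> liminf (\<lambda>i. \<integral>\<^sup>+x\<in>frontier P. v (k i) x \<partial>sg)" .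
  with k(1) u1 uc u_ent show ?thesis
    by (rule that)
qed

text \<open>The infimum is taken over \<open>A\<close>, the functions of finite boundary energy; all
  others have infinite free energy.\<close>

theorem minimizer_exists:
  "\<exists>u\<in>Mp crit P mu. \<forall>v\<in>Mp 1 P mu. free_energy P mu sg T u \<le> free_energy P mu sg T v"
proof -
  define bd where "bd v = (\<integral>\<^sup>+x\<in>frontier P. v x \<partial>sg)" for v
  define A where "A = {v \<in> Mp 1 P mu. bd v < \<infinity>}"
  define F where "F v = enn2real (bd v) + T * ulogu v" for v
  have bd: "bd v = ennreal (enn2real (bd v))" if "v \<in> A" for v
    using that by (simp add: A_def)
  have F_eq: "free_energy P mu sg T v = ereal (F v / vol)" if v: "v \<in> A" for v
  proof -
    have v1: "v \<in> Mp 1 P mu" using v by (simp add: A_def)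
    have b: "(\<integral>\<^sup>+x\<in>frontier P. v x \<partial>sg) = ennreal (enn2real (bd v))"
      using bd[OF v] by (simp add: bd_def)
    show ?thesis
      unfolding F_def using Mp1_facts(2)[OF v1 eq_refl[OF b]] b by (intro free_energy_eq[OF v1]) auto
  qed
  obtain K where "\<forall>v\<in>Mp 1 P mu. \<forall>B\<ge>0. (\<integral>\<^sup>+x\<in>frontier P. v x \<partial>sg) = ennreal B \<longrightarrow> B / 2 - K \<le> B + T * ulogu v"
    using coercive[of T] by (elim exE) (rule that)
  then have K: "enn2real (bd v) / 2 - K \<le> F v" if "v \<in> A" for v
    using that bd[OF that] by (simp add: A_def F_def bd_def)
  have one: "(\<lambda>_. 1) \<in> A"
    using one_Mp1 by (simp add: A_def bd_def)
  have bdd: "bdd_below (F ` A)"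
  proof (rule bdd_belowI2)
    fix v assume "v \<in> A"
    from K[OF this] show "- K \<le> F v"
      using enn2real_nonneg[of "bd v"] by linarith
  qed
  define m where "m = Inf (F ` A)"
  have m_le: "m \<le> F v" if "v \<in> A" for v
    unfolding m_def using that bdd by (intro cInf_lower) auto
  have "\<exists>v\<in>A. F v < m + 1 / (real i + 1)" for i
  proof -
    have "Inf (F ` A) < m + 1 / (real i + 1)"
      by (simp add: m_def add_pos_nonneg)
    then show ?thesis
      using one bdd by (subst (asm) cInf_less_iff) auto
  qed
  then obtain v where vA: "\<And>i. v i \<in> A" and vm: "\<And>i. F (v i) < m + 1 / (real i + 1)"
    by metis
  have v1: "v i \<in> Mp 1 P mu" for i
    using vA[of i] by (simp add: A_def)
  have Fv: "(\<lambda>i. F (v i)) \<longlonglongrightarrow> m"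
  proof (rule tendsto_sandwich[of "\<lambda>_. m" _ _ "\<lambda>i. m + 1 / (real i + 1)"])
    show "(\<lambda>i. m + 1 / (real i + 1)) \<longlonglongrightarrow> m"
      by real_asymp
    show "(\<lambda>i. m) \<longlonglongrightarrow> m" by simp
    show "eventually (\<lambda>i. m \<le> F (v i)) sequentially"
      using m_le[OF vA] by simp
    show "eventually (\<lambda>i. F (v i) \<le> m + 1 / (real i + 1)) sequentially"
      using less_imp_le[OF vm] by simp
  qed
  \<comment> \<open>This solves \<open>F (v i) < m + 1\<close> for the energy by the coercive bound;
    the maximum keeps \<open>B\<close> nonnegative.\<close>
  define B where "B = max 0 (2 * (m + 1 + K))"
  have vB: "bd (v i) \<le> ennreal B" for i
  proof -
    have "F (v i) < m + 1"
      using vm[of i] by (rule less_le_trans) simp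
    then have "enn2real (bd (v i)) \<le> 2 * (m + 1 + K)"
      using K[OF vA, of i] by simp
    then have "enn2real (bd (v i)) \<le> B"
      unfolding B_def by (rule max.coboundedI2)
    then show ?thesis
      by (subst bd[OF vA]) (rule ennreal_leI)
  qed
  have B: "0 \<le> B"
    by (simp add: B_def)
  obtain k u where k: "strict_mono (k :: nat \<Rightarrow> nat)" and u: "u \<in> Mp 1 P mu" "u \<in> Mp crit P mu"
    and ent: "(\<lambda>i. ulogu (v (k i))) \<longlonglongrightarrow> ulogu u"
    and "(\<integral>\<^sup>+x\<in>frontier P. u x \<partial>sg) \<le> liminf (\<lambda>i. \<integral>\<^sup>+x\<in>frontier P. v (k i) x \<partial>sg)"
    by (rule Mp1_compactness[OF v1 B vB[unfolded bd_def]]) (rule that)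
  then have fr: "bd u \<le> liminf (\<lambda>i. bd (v (k i)))"
    by (simp add: bd_def)
  \<comment> \<open>Both \<open>F\<close> and the entropy converge along the subsequence, hence so
    does the energy, and its lower limit is an exact value.\<close>
  have "(\<lambda>i. F (v (k i)) - T * ulogu (v (k i))) \<longlonglongrightarrow> m - T * ulogu u"
    using LIMSEQ_subseq_LIMSEQ[OF Fv k] ent by (intro tendsto_intros) (simp_all add: o_def)
  then have lim: "(\<lambda>i. enn2real (bd (v (k i)))) \<longlonglongrightarrow> m - T * ulogu u"
    by (simp add: F_def)
  have "(\<lambda>i. bd (v (k i))) = (\<lambda>i. ennreal (enn2real (bd (v (k i)))))"
    using bd[OF vA] by (rule ext)
  then have "(\<lambda>i. bd (v (k i))) \<longlonglongrightarrow> ennreal (m - T * ulogu u)"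
    using tendsto_ennrealI[OF lim] by simp
  then have "liminf (\<lambda>i. bd (v (k i))) = ennreal (m - T * ulogu u)"
    by (intro lim_imp_Liminf) simp_all
  with fr have bu: "bd u \<le> ennreal (m - T * ulogu u)"
    by simp
  then have uA: "u \<in> A"
    using u(1) by (auto simp: A_def intro: le_less_trans)
  \<comment> \<open>As a limit of energies this number is nonnegative, so \<open>ennreal\<close> has
    not truncated it.\<close>
  have "0 \<le> m - T * ulogu u"
    by (rule LIMSEQ_le_const[OF lim]) auto
  with bu have "enn2real (bd u) \<le> m - T * ulogu u"
    by (intro enn2real_leI) auto
  then have Fu: "F u \<le> m"
    by (simp add: F_def)
  show ?thesis
  proof (intro bexI[OF _ u(2)] ballI)
    fix v assume v: "v \<in> Mp 1 P mu"
    show "free_energy P mu sg T u \<le> free_energy P mu sg T v"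
    proof (cases "v \<in> A")
      case True
      then have "F u / vol \<le> F v / vol"
        using Fu m_le[OF True] vol_facts(1) by (intro divide_right_mono) auto
      then show ?thesis
        using True uA by (simp add: F_eq)
    next
      case False
      with v have "bd v = \<infinity>"
        by (simp add: A_def less_top[symmetric])
      then show ?thesis
        using free_energy_infinite[OF v] by (simp add: bd_def)
    qed
  qed
qed

end

theorem mainTheorem10:
  fixes P :: "(real^'n) set" and mu sg :: "(real^'n) measure" and T :: real
  assumes "CARD('n) \<ge> 2"
    and "CARD('n) = Suc CARD('m::finite)"
    and "system TYPE('m) P mu sg"
  shows "\<exists>u \<in> Mp (real CARD('n) / (real CARD('n) - 1)) P mu.
           \<forall>v \<in> Mp 1 P mu. free_energy P mu sg T u \<le> free_energy P mu sg T v"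
proof -
  obtain c where "c > 0" "mu = density lborel (\<lambda>_. ennreal c)"
    using assms(3) by (auto simp: system_def lebesgue_multiple_def)
  from minimizer_exists[OF assms this refl] show ?thesis .
qed

end
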